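(* Let $R$ be a finite ring with unit, $U(R)$ its multiplicative group of units, and consider the group $R\times U(R)$ (direct product of the additive group of $R$ and the multiplicative group $U(R)$), in which $(a,u)(b,v)^{-1}=(a-b,uv^{-1})$. Then the set $B=\{(x,x):x\in U(R)\}$ is a difference basis for the set $A=\{(x,y)\in R\times U(R):\exists z\in U(R)\ (y-1)z=x\}$ in $R\times U(R)$. If moreover $R$ is local with maximal ideal $I_{\mathfrak m}$ and residue field $F=R/I_{\mathfrak m}$, then $$\Delta[R\times U(R)]\le |U(R)|-2+\Delta[I_{\mathfrak m}\times U(R)]+\Delta[R\times(1+I_{\mathfrak m})]\le |U(R)|-2+\frac{4}{\sqrt3}\cdot\frac{|R|}{|F|}\big(\sqrt{|F|-1}+\sqrt{|F|}\big)$$ and $$\eth[R\times U(R)]<\sqrt{1-\frac{1}{|F|}}+\frac{4}{\sqrt3}\Big(\frac{1}{\sqrt{|F|}}+\frac{1}{\sqrt{|F|-1}}\Big).$$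
   Context: For a subset $A$ of a group $G$, a subset $B\subseteq G$ is a difference basis for $A$ if every $a\in A$ can be written as $a=xy^{-1}$ with $x,y\in B$. The difference size $\Delta[A]$ is the smallest cardinality of a difference basis for $A$, and $\eth[A]=\Delta[A]/\sqrt{|A|}$. A ring is local if it has a unique maximal ideal; the sets $I_{\mathfrak m}\times U(R)$ and $R\times(1+I_{\mathfrak m})$ are regarded as subsets of the group $R\times U(R)$. *)

theory Defs
  imports "HOL-Algebra.Algebra" Complex_Main
begin

definition difference_basis ::
    "('a, 'b) monoid_scheme \<Rightarrow> 'a set \<Rightarrow> 'a set \<Rightarrow> bool" where
  "difference_basis G A B \<longleftrightarrow>
     B \<subseteq> carrier G \<and> (\<forall>a\<in>A. \<exists>x\<in>B. \<exists>y\<in>B. a = x \<otimes>\<^bsub>G\<^esub> inv\<^bsub>G\<^esub> y)"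

text \<open>Only finite bases are counted: \<^const>\<open>card\<close> is 0 on infinite sets.  The minimum is
  meaningful for every finite subset of a group.\<close>

definition difference_size :: "('a, 'b) monoid_scheme \<Rightarrow> 'a set \<Rightarrow> nat" where
  "difference_size G A = (LEAST n. \<exists>B. finite B \<and> difference_basis G A B \<and> card B = n)"

definition difference_char :: "('a, 'b) monoid_scheme \<Rightarrow> 'a set \<Rightarrow> real" where
  "difference_char G A = real (difference_size G A) / sqrt (real (card A))"

definition add_units_group :: "('a, 'b) ring_scheme \<Rightarrow> ('a \<times> 'a) monoid" where
  "add_units_group R = add_monoid R \<times>\<times> units_of R"

lemma carrier_add_units_group: "carrier (add_units_group R) = carrier R \<times> Units R"
  by (simp add: add_units_group_def units_of_carrier)

lemma (in ring) group_add_units_group: "group (add_units_group R)"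
  unfolding add_units_group_def
  by (intro DirProd_group a_group units_group)

lemma (in ring) add_units_group_div:
  assumes "a \<in> carrier R" "b \<in> carrier R" "u \<in> Units R" "v \<in> Units R"
  shows "(a, u) \<otimes>\<^bsub>add_units_group R\<^esub> inv\<^bsub>add_units_group R\<^esub> (b, v) = (a \<ominus> b, u \<otimes> inv v)"
proof -
  have "inv\<^bsub>add_units_group R\<^esub> (b, v) = (\<ominus> b, inv v)"
    unfolding add_units_group_def
    using assms inv_DirProd[OF a_group units_group, of b v]
    by (simp add: units_of_carrier units_of_inv a_inv_def)
  then show ?thesis
    by (simp add: add_units_group_def units_of_mult a_minus_def)
qed

text \<open>Rings are not assumed commutative; \<^const>\<open>maximalideal\<close> refers to two-sided ideals.\<close>

definition local_ring :: "('a, 'b) ring_scheme \<Rightarrow> bool" where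
  "local_ring R \<longleftrightarrow> ring R \<and> (\<exists>!I. maximalideal I R)"

end

theory Submission
  imports Defs
begin

text \<open>
  If \<open>x\<close> and \<open>y - 1\<close> are both units, then \<open>(x, y)\<close> is a difference of two diagonal elements; in a
  local ring every other element of \<open>R \<times> U(R)\<close> lies in \<open>I \<times> U(R)\<close> or in \<open>R \<times> (1 + I)\<close>.  Translating
  optimal bases of these two subgroups so that they meet the diagonal in \<open>(1, 1)\<close> saves the \<open>2\<close>.

  For the two subgroups one needs the Kozma--Lev bound \<open>\<Delta>[H] \<le> 4/\<surd>3 \<surd>|H|\<close>, which in general rests on the
  classification of finite simple groups.  Here \<open>H\<close> has a chain of subgroups in which each is the
  union of the cosets \<open>K, Kx, Kx\<^sup>2, \<dots>\<close> of its predecessor \<open>K\<close>.  Where the orders cross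
  \<open>\<surd>(|H|/3)\<close>, every element of \<open>H\<close> is a product of a short run of these cosets and an element of
  a sparse set, with run length chosen to balance the two sizes.

  That \<open>1 + I\<close> consists of units uses no commutativity: if \<open>1 - x\<close> with \<open>x \<in> I\<close> lies in a maximal
  left ideal \<open>L\<close>, a density argument produces \<open>y \<in> I\<close> such that \<open>1 - y\<close> annihilates \<open>R/L\<close>; the
  annihilator is a proper ideal, hence contained in \<open>I\<close>, and \<open>1 \<in> I\<close> follows.
\<close>

subsection \<open>Balancing the two factors of a cover\<close>

text \<open>The bound is attained at \<open>a = b = 1/\<surd>3\<close>, \<open>n = 3\<close> with \<open>s = q = 2\<close>; in general \<open>s \<approx> 1/a\<close>.\<close>

lemma balanced_cover_ordered:
  fixes a b :: real and n :: nat
  assumes "0 < a" "b \<le> a" "a \<le> 1 / sqrt 3" "0 < b" "a * b * n = 1"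
  shows "\<exists>s q::nat. n \<le> s * q \<and> s * a + q * b \<le> 4 / sqrt 3"
proof -
  \<comment> \<open>Take \<open>q\<close> as n/s rounded up. Since n b = 1/a, rounding costs at most
    b (1 - 1/s), the last summand in \<open>le\<close>.\<close>
  have cover: ?thesis
    if "0 < s" and le: "s * a + 1 / (s * a) + b * (1 - 1 / s) \<le> 4 / sqrt 3" for s :: nat
  proof -
    define q where "q = (n + s - 1) div s"
    have n: "0 < n" using assms by (cases n) auto
    have 1: "s * q \<le> n + s - 1" unfolding q_def by simp
    have 2: "n \<le> s * q"
    proof -
      have "n + s - 1 < s * q + s"
        unfolding q_def using dividend_less_times_div[OF \<open>0 < s\<close>, of "n + s - 1"] by simp
      then show ?thesis by linarith
    qed
    have "real (s * q) \<le> real n + real s - 1"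
      using 1 \<open>0 < s\<close> n by linarith
    then have "real q \<le> (real n + real s - 1) / s"
      using \<open>0 < s\<close> by (simp add: field_simps)
    then have "q * b \<le> (real n + real s - 1) / s * b"
      using assms by (intro mult_right_mono) auto
    also have "\<dots> = n * b / s + b * (1 - 1 / s)"
      using \<open>0 < s\<close> by (simp add: field_simps)
    also have "n * b = 1 / a" using assms by (simp add: field_simps)
    finally have "s * a + q * b \<le> 4 / sqrt 3" using le by (simp add: mult.commute)
    with 2 show ?thesis by blast
  qed
  define r where "r = sqrt (3::real)"
  have "433/250 < r" unfolding r_def by (rule real_less_rsqrt) (simp add: power2_eq_square)
  moreover have "r < 17321/10000" unfolding r_def by (rule real_less_lsqrt) (simp_all add: power2_eq_square)
  ultimately have r: "r * r = 3" "r > 0" "433/250 < r" "r < 17321/10000"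
    unfolding r_def by auto
  have r4: "4 / sqrt 3 = 4 * r / 3" "1 / sqrt 3 = r / 3"
    using r(1,2) unfolding r_def by (auto simp: field_simps)
  \<comment> \<open>The cases use s = 2, s = 3 and the s nearest to 1/a. With b \<le> a the sum for
    s = 2 is at most (5 a^2 + 1)/(2 a), which stays below 4/\<surd>3 exactly between r/5 and
    r/3.\<close>
  consider "a \<ge> r / 5" | "a \<le> r / 5" "a \<ge> 1 / 4" | "a \<le> 1 / 4" by linarith
  then show ?thesis
  proof cases
    case 1
    have "(a - r / 5) * (a - r / 3) \<le> 0"
      using 1 assms r4 by (intro mult_nonneg_nonpos) auto
    then have "5 * a * a + 1 \<le> 8 * r / 3 * a" using r(1)
      by (simp add: algebra_simps)
    then have "2 * a + 1 / (2 * a) + a / 2 \<le> 4 * r / 3"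
      using assms by (simp add: field_simps)
    then have "2 * a + 1 / (2 * a) + b * (1 - 1 / 2) \<le> 4 / sqrt 3"
      using assms(2) unfolding r4(1) by simp
    then show ?thesis by (intro cover[of 2]) simp_all
  next
    case 2
    \<comment> \<open>For s = 3 the target is 11 a^2 + 1 \<le> 4 r a. The square is bounded by its
      chord over [1/4, r/5]; the remaining linear inequality is tightest at a = 1/4.\<close>
    have "(a - 1 / 4) * (a - r / 5) \<le> 0"
      using 2 by (intro mult_nonneg_nonpos) auto
    then have "11 * (a * a) + 11 * r / 20 \<le> 11 * (1/4 + r / 5) * a"
      by (simp add: algebra_simps)
    moreover have "11 * (1/4 + r / 5) * a - 4 * r * a \<le> 11 * r / 20 - 1"
    proof -
      have "11 * (1/4 + r / 5) * a - 4 * r * a = (11/4 - 9/5 * r) * a"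
        by (simp add: algebra_simps)
      also have "\<dots> \<le> (11/4 - 9/5 * r) * (1/4)"
        using 2 r by (intro mult_left_mono_neg) auto
      also have "\<dots> \<le> 11 * r / 20 - 1" using r by simp
      finally show ?thesis .
    qed
    ultimately have "11 * (a * a) + 1 \<le> 4 * r * a" by linarith
    then have "3 * a + 1 / (3 * a) + a * (2 / 3) \<le> 4 * r / 3"
      using assms by (simp add: field_simps)
    then have "3 * a + 1 / (3 * a) + b * (1 - 1 / 3) \<le> 4 / sqrt 3"
      using assms(2) unfolding r4(1) by simp
    then show ?thesis by (intro cover[of 3]) simp_all
  next
    case 3
    define s where "s = nat (round (1 / a))"
    have ge: "1 / a \<ge> 4" using 3 assms by (simp add: field_simps)
    have rd: "\<bar>of_int (round (1 / a)) - 1 / a\<bar> \<le> 1 / 2" by (rule of_int_round_abs_le)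
    then have sr: "real s = of_int (round (1 / a))" unfolding s_def using ge by linarith
    have s: "\<bar>s - 1 / a\<bar> \<le> 1 / 2" "0 < s"
      using rd ge sr by linarith+
    have "\<bar>s * a - 1\<bar> = \<bar>s - 1 / a\<bar> * a" using assms by (simp add: abs_mult_pos field_simps)
    also have "\<dots> \<le> 1 / 2 * (1 / 4)" using s 3 assms by (intro mult_mono) auto
    finally have u: "7 / 8 \<le> s * a" "s * a \<le> 9 / 8" by linarith+
    \<comment> \<open>7/8 and 8/7 are reciprocal, so u + 1/u is at most their sum for every u
      between them, in particular up to 9/8.\<close>
    have "(s * a - 7 / 8) * (s * a - 8 / 7) \<le> 0"
      using u by (intro mult_nonneg_nonpos) auto
    then have "s * a + 1 / (s * a) \<le> 7 / 8 + 8 / 7"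
      using u assms s by (simp add: field_simps)
    moreover have "b * (1 - 1 / s) \<le> 1 / 4 * 1" using s assms 3 by (intro mult_mono) auto
    ultimately have "s * a + 1 / (s * a) + b * (1 - 1 / s) \<le> 4 / sqrt 3"
      using r unfolding r4(1) by linarith
    then show ?thesis using cover s by blast
  qed
qed

text \<open>Extends the range of b to what a crossing of subgroup orders provides. Exchanging (s, a)
  with (q, b) settles b \<le> 1/\<surd>3; for larger b the choice s = n, q = 1 works.\<close>

lemma balanced_cover:
  fixes a b :: real and n :: nat
  assumes "0 < a" "a \<le> 1 / sqrt 3" "0 < b" "b \<le> sqrt 3" "a * b * n = 1"
  shows "\<exists>s q::nat. n \<le> s * q \<and> s * a + q * b \<le> 4 / sqrt 3"
proof -
  consider "b \<le> a" | "a \<le> b" "b \<le> 1 / sqrt 3" | "1 / sqrt 3 \<le> b" by linarith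
  then show ?thesis
  proof cases
    case 1
    then show ?thesis using balanced_cover_ordered assms by blast
  next
    case 2
    then obtain s q where "n \<le> s * q" "s * b + q * a \<le> 4 / sqrt 3"
      using balanced_cover_ordered[of b a n] assms by (auto simp: mult.commute)
    then have "n \<le> q * s \<and> q * a + s * b \<le> 4 / sqrt 3" by (simp add: ac_simps)
    then show ?thesis by blast
  next
    case 3
    \<comment> \<open>The endpoints are reciprocal with sum 4/\<surd>3, hence b + 1/b \<le>
      4/\<surd>3 between them, and n a = 1/b.\<close>
    have "(b - 1 / sqrt 3) * (b - sqrt 3) \<le> 0"
      using 3 assms by (intro mult_nonneg_nonpos) auto
    then have "b * b + 1 \<le> (1 / sqrt 3 + sqrt 3) * b" by (simp add: algebra_simps diff_divide_distrib)
    moreover have "1 / sqrt 3 + sqrt 3 = 4 / sqrt (3::real)" by (simp add: field_simps)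
    ultimately have "1 / b + b \<le> 4 / sqrt 3"
      using assms by (simp add: field_simps)
    moreover have "n * a = 1 / b" using assms by (simp add: field_simps)
    ultimately have "n \<le> n * 1 \<and> n * a + 1 * b \<le> 4 / sqrt 3" by simp
    then show ?thesis by (metis of_nat_1)
  qed
qed

subsection \<open>Difference sizes in groups with cyclic sections\<close>

lemma difference_size_le:
  "finite B \<Longrightarrow> difference_basis G A B \<Longrightarrow> difference_size G A \<le> card B"
  unfolding difference_size_def by (rule Least_le) blast

lemma difference_basis_Un:
  assumes "difference_basis G A B" "difference_basis G A' B'"
  shows "difference_basis G (A \<union> A') (B \<union> B')"
  using assms unfolding difference_basis_def by blast

lemma difference_basis_mono:
  assumes "difference_basis G A B" "A' \<subseteq> A"
  shows "difference_basis G A' B"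
  using assms unfolding difference_basis_def by blast

context group
begin

lemma ex_minimal_difference_basis:
  assumes "finite A" "A \<subseteq> carrier G"
  shows "\<exists>B. finite B \<and> difference_basis G A B \<and> card B = difference_size G A"
proof -
  have "difference_basis G A (insert \<one> A)"
    using assms unfolding difference_basis_def by force
  then have "\<exists>n B. finite B \<and> difference_basis G A B \<and> card B = n"
    using assms by blast
  from LeastI_ex[OF this] show ?thesis unfolding difference_size_def .
qed

text \<open>Right translation leaves every quotient of two basis elements unchanged, so a minimal
  basis can be moved onto any prescribed \<open>g\<close>.\<close>

lemma ex_minimal_difference_basis_containing:
  assumes "finite A" "A \<subseteq> carrier G" "A \<noteq> {}" "g \<in> carrier G"
  shows "\<exists>B. finite B \<and> difference_basis G A B \<and> card B = difference_size G A \<and> g \<in> B"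
proof -
  obtain B where B: "finite B" "difference_basis G A B" "card B = difference_size G A"
    using ex_minimal_difference_basis assms by blast
  then have BG: "B \<subseteq> carrier G" unfolding difference_basis_def by blast
  obtain b where b: "b \<in> B" using B assms unfolding difference_basis_def by blast
  define c where "c = inv b \<otimes> g"
  have c: "c \<in> carrier G" "b \<otimes> c = g"
    using b BG assms unfolding c_def by (auto simp: m_assoc[symmetric])
  define B' where "B' = (\<lambda>x. x \<otimes> c) ` B"
  have "inj_on (\<lambda>x. x \<otimes> c) B" using BG c(1) by (intro inj_onI) (meson right_cancel subsetD)
  then have "card B' = card B" unfolding B'_def by (rule card_image)
  moreover have "g \<in> B'" unfolding B'_def using b c by force
  moreover have "finite B'" unfolding B'_def using B by simp
  moreover have "difference_basis G A B'"
    unfolding difference_basis_def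
  proof (intro conjI ballI)
    show "B' \<subseteq> carrier G" unfolding B'_def using BG c by auto
    fix a assume "a \<in> A"
    then obtain x y where xy: "x \<in> B" "y \<in> B" "a = x \<otimes> inv y"
      using B unfolding difference_basis_def by blast
    then have "x \<in> carrier G" "y \<in> carrier G" using BG by auto
    then have "a = (x \<otimes> c) \<otimes> inv (y \<otimes> c)"
      using xy c inv_solve_left[of "inv y" c "inv c \<otimes> inv y"]
      by (simp add: inv_mult_group m_assoc) (simp add: m_assoc[symmetric])
    then show "\<exists>x\<in>B'. \<exists>y\<in>B'. a = x \<otimes> inv y" unfolding B'_def using xy by blast
  qed
  ultimately show ?thesis using B by metis
qed

text \<open>Writing a b as the quotient of a by the inverse of b, the set \<open>A\<close> together
  with the inverses of \<open>B\<close> is a difference basis.\<close>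

lemma difference_size_le_product:
  assumes "finite A" "finite B" "A \<subseteq> carrier G" "B \<subseteq> carrier G" "H \<subseteq> A <#> B"
  shows "difference_size G H \<le> card A + card B"
proof -
  have "difference_basis G H (A \<union> (\<lambda>b. inv b) ` B)"
    unfolding difference_basis_def
  proof (intro conjI ballI)
    fix h assume "h \<in> H"
    then obtain a b where ab: "a \<in> A" "b \<in> B" "h = a \<otimes> b"
      using assms unfolding set_mult_def by blast
    then have "h = a \<otimes> inv (inv b)" using assms by auto
    with ab show "\<exists>x\<in>A \<union> (\<lambda>b. inv b) ` B. \<exists>y\<in>A \<union> (\<lambda>b. inv b) ` B. h = x \<otimes> inv y" by blast
  qed (use assms in auto)
  then have "difference_size G H \<le> card (A \<union> (\<lambda>b. inv b) ` B)"
    using assms by (intro difference_size_le) auto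
  also have "\<dots> \<le> card A + card ((\<lambda>b. inv b) ` B)" by (rule card_Un_le)
  also have "\<dots> \<le> card A + card B" using assms card_image_le by auto
  finally show ?thesis .
qed

section \<open>Covers by right cosets, and towers of cyclic sections\<close>

lemma ex_right_transversal:
  assumes "finite H" "subgroup H G" "subgroup L G" "L \<subseteq> H"
  shows "\<exists>T\<subseteq>H. card T * card L = card H \<and> H = (\<Union>t\<in>T. L #> t)"
proof -
  let ?H = "G\<lparr>carrier := H\<rparr>"
  interpret H: group ?H using assms(2) by (rule subgroup_imp_group)
  have L: "subgroup L ?H" using assms subgroup_incl by blast
  have cos: "rcosets\<^bsub>?H\<^esub> L = {L #> t |t. t \<in> H}" by (auto simp: RCOSETS_def r_coset_def)
  define f where "f c = (SOME t. t \<in> H \<and> c = L #> t)" for c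
  have f: "f c \<in> H" "c = L #> f c" if "c \<in> rcosets\<^bsub>?H\<^esub> L" for c
    using someI_ex[of "\<lambda>t. t \<in> H \<and> c = L #> t"] that unfolding cos f_def by blast+
  have "inj_on f (rcosets\<^bsub>?H\<^esub> L)" by (metis f(2) inj_onI)
  then have "card (f ` (rcosets\<^bsub>?H\<^esub> L)) * card L = card H"
    using H.lagrange_finite[OF _ L] assms by (simp add: card_image order_def)
  moreover have "\<Union>(rcosets\<^bsub>?H\<^esub> L) = H" using H.rcosets_part_G[OF L] by simp
  then have "H = (\<Union>t\<in>f ` (rcosets\<^bsub>?H\<^esub> L). L #> t)" using f(2) by auto
  ultimately show ?thesis using f(1) by (intro exI[of _ "f ` (rcosets\<^bsub>?H\<^esub> L)"]) blast
qed

lemma card_r_coset: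
  assumes "K \<subseteq> carrier G" "x \<in> carrier G"
  shows "card (K #> x) = card K"
  using assms card_rcosets_equal[of "K #> x" K] rcosetsI by metis

text \<open>Splitting j = j mod s + s (j div s) writes an element of \<open>L\<close> as a product
  from a run of s cosets of \<open>K\<close> and one of q sparse powers of x; a transversal of
  \<open>L\<close> extends this to \<open>H\<close>. The two factors have at most s |K| and q
  |H|/|L| elements, and multiplying by |L| keeps the estimate in the naturals.\<close>

lemma difference_size_le_cyclic_section:
  assumes fin: "finite H" and H: "subgroup H G" and L: "subgroup L G" and K: "subgroup K G"
    and LH: "L \<subseteq> H" and x: "x \<in> carrier G" and LK: "L = (\<Union>j<n. K #> x [^] (j::nat))"
    and n: "n \<le> s * q"
  shows "difference_size G H * card L \<le> s * card K * card L + q * card H"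
proof -
  obtain T where T: "T \<subseteq> H" "card T * card L = card H" "H = (\<Union>t\<in>T. L #> t)"
    using ex_right_transversal[OF fin H L LH] by blast
  have HG: "H \<subseteq> carrier G" and KG: "K \<subseteq> carrier G" using H K subgroup.subset by auto
  have TG: "T \<subseteq> carrier G" and finT: "finite T" using T HG fin finite_subset by auto
  define A where "A = (\<Union>r<s. K #> x [^] r)"
  define B where "B = (\<lambda>(i, t). x [^] (s * i) \<otimes> t) ` ({..<q} \<times> T)"
  have AG: "A \<subseteq> carrier G" unfolding A_def using KG x by (auto simp: r_coset_def)
  have BG: "B \<subseteq> carrier G" unfolding B_def using TG x by auto
  have cover: "H \<subseteq> A <#> B"
  proof
    fix h assume "h \<in> H"
    then obtain t l where t: "t \<in> T" "l \<in> L" "h = l \<otimes> t" using T unfolding r_coset_def by blast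
    then obtain j k where j: "j < n" "k \<in> K" "l = k \<otimes> x [^] j"
      using LK unfolding r_coset_def by blast
    have s: "0 < s" using j n by (cases s) auto
    have "j div s < q" using j n s by (simp add: div_less_iff_less_mult mult.commute)
    then have "x [^] (s * (j div s)) \<otimes> t \<in> B" unfolding B_def using t by force
    moreover have "k \<otimes> x [^] (j mod s) \<in> A"
      unfolding A_def r_coset_def using j s by force
    moreover have "h = (k \<otimes> x [^] (j mod s)) \<otimes> (x [^] (s * (j div s)) \<otimes> t)"
    proof -
      have "x [^] j = x [^] (j mod s) \<otimes> x [^] (s * (j div s))"
        using x by (simp add: nat_pow_mult)
      moreover have "k \<in> carrier G" "t \<in> carrier G" using j t KG TG by auto
      ultimately show ?thesis using t j x by (simp add: m_assoc)
    qed
    ultimately show "h \<in> A <#> B" unfolding set_mult_def by blast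
  qed
  have finK: "finite (K #> x [^] r)" if "r < n" for r :: nat
    using LK LH fin finite_subset that by (metis UN_upper lessThan_iff)
  show ?thesis
  proof (cases "n = 0")
    case True
    then have "L = {}" using LK by auto
    then show ?thesis using L subgroup.one_closed by auto
  next
    case False
    then have "finite (K #> x [^] (0::nat))" using finK by blast
    then have finK: "finite K" using KG by (simp add: coset_mult_one)
    have finA: "finite A" unfolding A_def r_coset_def using finK by auto
    have "card A \<le> (\<Sum>r<s. card (K #> x [^] r))"
      unfolding A_def by (rule card_UN_le) auto
    also have "\<dots> = s * card K" using card_r_coset KG x by simp
    finally have cA: "card A \<le> s * card K" .
    have finB: "finite B" unfolding B_def using finT by auto
    have "card B \<le> card ({..<q} \<times> T)" unfolding B_def using finT by (intro card_image_le) auto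
    then have cB: "card B \<le> q * card T" by (simp add: card_cartesian_product)
    have "difference_size G H \<le> s * card K + q * card T"
      using difference_size_le_product[OF finA finB AG BG cover] cA cB by linarith
    then have "difference_size G H * card L \<le> (s * card K + q * card T) * card L"
      by (rule mult_right_mono) simp
    then show ?thesis using T(2) by (simp add: algebra_simps)
  qed
qed

text \<open>For finite \<open>L\<close> the cardinality equation says that the n listed cosets are
  disjoint. Normality of \<open>K\<close> in \<open>L\<close> is not demanded, so no quotient group
  appears.\<close>

definition cyclic_section :: "'a set \<Rightarrow> 'a set \<Rightarrow> bool" where
  "cyclic_section K L \<longleftrightarrow> subgroup K G \<and> subgroup L G \<and> K \<subseteq> L \<and>
     (\<exists>x\<in>L. \<exists>n. L = (\<Union>j<n. K #> x [^] (j::nat)) \<and> card L = n * card K)"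

inductive cyclic_tower :: "'a set \<Rightarrow> bool" where
  trivial: "cyclic_tower {\<one>}"
| step: "\<lbrakk>cyclic_tower K; cyclic_section K H\<rbrakk> \<Longrightarrow> cyclic_tower H"

text \<open>A single coset with the identity as generator; it serves the crossing argument at the
  trivial group.\<close>

lemma cyclic_section_refl:
  assumes "subgroup K G"
  shows "cyclic_section K K"
proof -
  have "K = (\<Union>j<1. K #> \<one> [^] (j::nat))"
    using subgroup.subset[OF assms] by (simp add: lessThan_Suc coset_mult_one)
  moreover have "card K = 1 * card K" by simp
  ultimately show ?thesis
    using assms subgroup.one_closed[OF assms] unfolding cyclic_section_def by blast
qed

lemma cyclic_tower_imp_subgroup: "cyclic_tower H \<Longrightarrow> subgroup H G"
  by (induction rule: cyclic_tower.induct) (auto simp: triv_subgroup cyclic_section_def)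

text \<open>Descending from \<open>H\<close>, either the predecessor \<open>K\<close> still reaches
  the threshold, or the link from \<open>K\<close> to \<open>H\<close> crosses it.\<close>

lemma cyclic_tower_crossing:
  fixes a :: real
  assumes "cyclic_tower H" "1 \<le> a" "a \<le> card H"
  shows "\<exists>K L. cyclic_section K L \<and> L \<subseteq> H \<and> card K \<le> a \<and> a \<le> card L"
  using assms
proof (induction rule: cyclic_tower.induct)
  case trivial
  then show ?case using cyclic_section_refl[OF triv_subgroup] by fastforce
next
  case (step K H)
  have "K \<subseteq> H" using step.hyps unfolding cyclic_section_def by blast
  show ?case
  proof (cases "a \<le> card K")
    case True
    with step.IH step.prems \<open>K \<subseteq> H\<close> show ?thesis by (meson order_trans)
  next
    case False
    then have "card K \<le> a" by simp
    with step show ?thesis by blast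
  qed
qed

theorem difference_size_cyclic_tower:
  assumes fin: "finite H" and tower: "cyclic_tower H"
  shows "difference_size G H \<le> 4 / sqrt 3 * sqrt (card H)"
proof -
  define N where "N = real (card H)"
  have H: "subgroup H G" using tower by (rule cyclic_tower_imp_subgroup)
  have HG: "H \<subseteq> carrier G" using H subgroup.subset by blast
  have H1: "\<one> \<in> H" using H subgroup.one_closed by blast
  have N1: "1 \<le> N" unfolding N_def using H1 fin by (simp add: Suc_le_eq card_gt_0_iff) blast
  show ?thesis
  \<comment> \<open>Below three elements the crossing threshold \<surd>(N/3) is less than 1, and
    \<open>H\<close> itself is a good enough basis.\<close>
  proof (cases "N < 3")
    case True
    have "difference_basis G H H" using HG H1 unfolding difference_basis_def by force
    then have "difference_size G H \<le> N" unfolding N_def using difference_size_le fin by fastforce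
    also have "N = sqrt N * sqrt N" using N1 by simp
    also have "\<dots> \<le> 4 / sqrt 3 * sqrt N"
    proof (rule mult_right_mono)
      have "sqrt N \<le> sqrt 3" using True by simp
      also have "sqrt 3 \<le> 4 / sqrt (3::real)" by (simp add: field_simps)
      finally show "sqrt N \<le> 4 / sqrt 3" .
    qed (use N1 in simp)
    finally show ?thesis unfolding N_def .
  next
    case False
    define w where "w = sqrt N"
    have w: "0 < w" "w * w = N" "sqrt 3 \<le> w" unfolding w_def using N1 False by auto
    have "1 \<le> w / sqrt 3" using w by (simp add: field_simps)
    moreover have "w / sqrt 3 \<le> N"
    proof -
      have "w / sqrt 3 \<le> w * 1" using w by (simp add: field_simps)
      also have "\<dots> \<le> w * w" using w N1 w_def by (intro mult_left_mono) auto
      finally show ?thesis using w by simp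
    qed
    ultimately obtain K L where KL: "cyclic_section K L" "L \<subseteq> H"
      and cK: "real (card K) \<le> w / sqrt 3" and cL: "w / sqrt 3 \<le> real (card L)"
      using cyclic_tower_crossing[OF tower, of "w / sqrt 3"] unfolding N_def by blast
    then obtain x n where K: "subgroup K G" and L: "subgroup L G" "L \<subseteq> H" "x \<in> L"
      "L = (\<Union>j<n. K #> x [^] (j::nat))" and n: "card L = n * card K"
      unfolding cyclic_section_def by metis
    note c = n cK cL
    \<comment> \<open>Sizes are measured in units of w = \<surd>|H|: then s |K| + q |H|/|L| = w (s a
      + q b), and |L| = n |K| becomes a b n = 1.\<close>
    define a b where "a = card K / w" and "b = w / card L"
    have l0: "0 < card L" using c(3) w by (smt (verit) divide_pos_pos of_nat_0 of_nat_0_less_iff real_sqrt_gt_0_iff)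
    then have k0: "0 < card K" "0 < n" using c(1) by (auto intro: Nat.gr0I)
    have "a * b * n = 1" unfolding a_def b_def using w c(1) l0 k0 by (simp add: field_simps)
    moreover have "0 < a" "0 < b" unfolding a_def b_def using w l0 k0 by auto
    moreover have "a \<le> 1 / sqrt 3" "b \<le> sqrt 3"
      unfolding a_def b_def using w l0 c by (auto simp: field_simps)
    ultimately obtain s q where sq: "n \<le> s * q" "s * a + q * b \<le> 4 / sqrt 3"
      using balanced_cover by blast
    have xG: "x \<in> carrier G" using L HG by blast
    have "real (difference_size G H * card L) \<le> real (s * card K * card L + q * card H)"
      using difference_size_le_cyclic_section[OF fin H L(1) K L(2) xG L(4) sq(1)]
      by (rule of_nat_mono)
    also have "\<dots> = (s * a + q * b) * w * card L"
      unfolding a_def b_def using w l0 by (simp add: field_simps N_def)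
    also have "\<dots> \<le> 4 / sqrt 3 * w * card L" using sq w by (intro mult_right_mono) auto
    finally have "real (difference_size G H) * card L \<le> 4 / sqrt 3 * w * card L" by simp
    then have "real (difference_size G H) \<le> 4 / sqrt 3 * w"
      by (rule mult_right_le_imp_le) (use l0 in simp)
    then show ?thesis unfolding w_def N_def .
  qed
qed

text \<open>The last hypothesis puts all commutators of \<open>H\<close> into \<open>K\<close>, so
  for x in \<open>H\<close> the cosets of \<open>K\<close> by powers of x form a subgroup. Adjoining
  one new x at a time enlarges \<open>K\<close> until it is \<open>H\<close>.\<close>

lemma cyclic_tower_abelian_extension:
  assumes fin: "finite (carrier G)" and H: "subgroup H G"
    and "cyclic_tower K" "K \<subseteq> H"
    and "\<And>x y. \<lbrakk>x \<in> H; y \<in> H\<rbrakk> \<Longrightarrow> \<exists>k\<in>K. x \<otimes> y = k \<otimes> (y \<otimes> x)"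
  shows "cyclic_tower H"
  using assms(3-)
proof (induction "card H - card K" arbitrary: K rule: less_induct)
  case less
  have HG: "H \<subseteq> carrier G" using H subgroup.subset by blast
  have K: "subgroup K G" using less cyclic_tower_imp_subgroup by blast
  have KG: "K \<subseteq> carrier G" using K subgroup.subset by blast
  have finH: "finite H" using fin HG finite_subset by blast
  show ?case
  proof (cases "K = H")
    case True
    then show ?thesis using less by simp
  next
    case False
    then obtain x where x: "x \<in> H" "x \<notin> K" using less by blast
    have xG: "x \<in> carrier G" using x HG by blast
    \<comment> \<open>The order of x modulo \<open>K\<close>; the order of \<open>G\<close> is an
      admissible exponent, so the minimum exists.\<close>
    define n where "n = (LEAST n. 0 < n \<and> x [^] (n::nat) \<in> K)"
    have "0 < order G \<and> x [^] order G \<in> K"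
      using fin xG K pow_order_eq_1 order_gt_0_iff_finite subgroup.one_closed by auto
    then have n: "0 < n" "x [^] n \<in> K" unfolding n_def
      using LeastI[of "\<lambda>n. 0 < n \<and> x [^] (n::nat) \<in> K"] by blast+
    have n_least: "x [^] j \<notin> K" if "0 < j" "j < n" for j :: nat
      using that not_less_Least unfolding n_def by blast
    define L where "L = (\<Union>j<n. K #> x [^] (j::nat))"
    \<comment> \<open>Exponents may be reduced modulo n because the powers of \<open>x [^] n\<close>
      are absorbed by \<open>K\<close>.\<close>
    have in_L: "k \<otimes> x [^] j \<in> L" if "k \<in> K" for k and j :: nat
    proof -
      have "x [^] j = x [^] (n * (j div n)) \<otimes> x [^] (j mod n)" using xG by (simp add: nat_pow_mult)
      also have "x [^] (n * (j div n)) = (x [^] n) [^] (j div n)" using xG by (simp add: nat_pow_pow)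
      finally have "k \<otimes> x [^] j = (k \<otimes> (x [^] n) [^] (j div n)) \<otimes> x [^] (j mod n)"
        using that KG xG n by (simp add: m_assoc subset_iff)
      moreover have "(x [^] n) [^] (j div n) \<in> K"
      proof -
        have "y [^] i \<in> K" if "y \<in> K" for y and i :: nat
          using K that by (induction i) (auto intro: subgroup.one_closed subgroup.m_closed)
        then show ?thesis using n by blast
      qed
      ultimately show ?thesis unfolding L_def r_coset_def
        using that K n subgroup.m_closed by fastforce
    qed
    have L_E: "\<exists>k\<in>K. \<exists>j::nat. y = k \<otimes> x [^] j" if "y \<in> L" for y
      using that unfolding L_def r_coset_def by blast
    have pow_H: "y [^] i \<in> H" if "y \<in> H" for y and i :: nat
      using H that by (induction i) (auto intro: subgroup.one_closed subgroup.m_closed)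
    have LH: "L \<subseteq> H"
      using L_E pow_H x less.prems subgroup.m_closed[OF H] by blast
    have KL: "K \<subseteq> L"
    proof
      fix k assume "k \<in> K"
      then show "k \<in> L" using in_L[of k 0] KG by auto
    qed
    have "x \<in> L" using in_L[of \<one> 1] K xG subgroup.one_closed by auto
    have mult: "y \<otimes> z \<in> L" if yz: "y \<in> L" "z \<in> L" for y z
    proof -
      obtain k j where k: "k \<in> K" "y = k \<otimes> x [^] (j::nat)" using L_E yz by blast
      obtain k' j' where k': "k' \<in> K" "z = k' \<otimes> x [^] (j'::nat)" using L_E yz by blast
      \<comment> \<open>Moving k' to the left past the power of x costs only a commutator c in
        \<open>K\<close>.\<close>
      obtain c where c: "c \<in> K" "x [^] j \<otimes> k' = c \<otimes> (k' \<otimes> x [^] j)"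
        using less.prems(3)[of "x [^] j" k'] pow_H x k' less.prems(2) by blast
      have "k \<in> carrier G" "k' \<in> carrier G" "c \<in> carrier G" using k k' c KG by auto
      then have "y \<otimes> z = k \<otimes> (x [^] j \<otimes> k') \<otimes> x [^] j'" using k k' xG by (simp add: m_assoc)
      also have "\<dots> = (k \<otimes> (c \<otimes> k')) \<otimes> x [^] (j + j')"
        using \<open>k \<in> carrier G\<close> \<open>k' \<in> carrier G\<close> \<open>c \<in> carrier G\<close> c xG
        by (simp add: m_assoc nat_pow_mult[symmetric])
      also have "\<dots> \<in> L" using in_L k k' c K subgroup.m_closed by metis
      finally show ?thesis .
    qed
    have one: "\<one> \<in> L" using KL K subgroup.one_closed by blast
    have "subgroup L G"
    proof (rule subgroupI)
      fix y assume y: "y \<in> L"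
      then have yG: "y \<in> carrier G" using LH HG by blast
      have pow: "y [^] i \<in> L" for i :: nat using one mult y by (induction i) auto
      \<comment> \<open>In a finite group the inverse is a nonnegative power, so closure under
        products suffices.\<close>
      have "y [^] (order G - 1) \<otimes> y = y [^] Suc (order G - 1)" by simp
      also have "\<dots> = \<one>" using pow_order_eq_1[OF yG] fin order_gt_0_iff_finite by simp
      finally have "inv y = y [^] (order G - 1)" using yG by (simp add: inv_equality)
      then show "inv y \<in> L" using pow by simp
    qed (use LH HG one mult in auto)
    moreover have "card L = n * card K"
    proof -
      \<comment> \<open>A common element would put \<open>x [^] (j - i)\<close> into
        \<open>K\<close>, against the minimality of n.\<close>
      have disj: "(K #> x [^] i) \<inter> (K #> x [^] j) = {}" if "i < j" "j < n" for i j :: nat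
      proof (rule ccontr)
        assume "(K #> x [^] i) \<inter> (K #> x [^] j) \<noteq> {}"
        then obtain k k' where k: "k \<in> K" "k' \<in> K" "k \<otimes> x [^] i = k' \<otimes> x [^] j"
          unfolding r_coset_def by blast
        have kG: "k \<in> carrier G" "k' \<in> carrier G" using k KG by auto
        have "x [^] j = x [^] (j - i) \<otimes> x [^] i" using that xG by (simp add: nat_pow_mult)
        then have "k \<otimes> x [^] i = (k' \<otimes> x [^] (j - i)) \<otimes> x [^] i"
          using k kG xG by (simp add: m_assoc)
        then have "k = k' \<otimes> x [^] (j - i)" using kG xG by simp
        then have "x [^] (j - i) = inv k' \<otimes> k" using kG xG by (simp add: m_assoc[symmetric])
        then have "x [^] (j - i) \<in> K"
          using k K subgroup.m_closed subgroup.m_inv_closed by metis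
        then show False using n_least[of "j - i"] that by simp
      qed
      have "card L = (\<Sum>j<n. card (K #> x [^] j))"
        unfolding L_def
      proof (rule card_UN_disjoint)
        show "\<forall>i\<in>{..<n}. \<forall>j\<in>{..<n}. i \<noteq> j \<longrightarrow> (K #> x [^] i) \<inter> (K #> x [^] j) = {}"
          using disj by (metis Int_commute lessThan_iff linorder_neqE_nat)
        show "\<forall>i\<in>{..<n}. finite (K #> x [^] i)"
          using finite_subset[OF LH finH] unfolding L_def by simp
      qed simp
      then show ?thesis using card_r_coset KG xG by simp
    qed
    ultimately have "cyclic_section K L"
      unfolding cyclic_section_def using K KL \<open>x \<in> L\<close> L_def by blast
    with less.prems(1) have tower: "cyclic_tower L" by (rule cyclic_tower.step)
    have "K \<subset> L" using KL \<open>x \<in> L\<close> x by blast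
    then have "card K < card L" using LH finH finite_subset psubset_card_mono by metis
    moreover have "card L \<le> card H" using LH finH card_mono by blast
    ultimately have "card H - card L < card H - card K" by linarith
    then show ?thesis using less.hyps[OF _ tower LH] less.prems(3) KL by blast
  qed
qed

end

subsection \<open>Units of finite local rings\<close>

text \<open>Since (y - 1) z = y z - z and y is the quotient of y z by z, the pair is the quotient of
  the diagonal elements at y z and at z.\<close>

lemma (in ring) difference_basis_diagonal:
  "difference_basis (add_units_group R)
     {(x, y). x \<in> carrier R \<and> y \<in> Units R \<and> (\<exists>z\<in>Units R. (y \<ominus> \<one>) \<otimes> z = x)}
     {(x, x) |x. x \<in> Units R}"
  unfolding difference_basis_def
proof (intro conjI ballI)
  show "{(x, x) |x. x \<in> Units R} \<subseteq> carrier (add_units_group R)"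
    by (auto simp: carrier_add_units_group)
  fix a assume "a \<in> {(x, y). x \<in> carrier R \<and> y \<in> Units R \<and> (\<exists>z\<in>Units R. (y \<ominus> \<one>) \<otimes> z = x)}"
  then obtain y z where a: "a = ((y \<ominus> \<one>) \<otimes> z, y)" and U: "y \<in> Units R" "z \<in> Units R" by blast
  have c: "y \<in> carrier R" "z \<in> carrier R" "y \<otimes> z \<in> Units R" "y \<otimes> z \<in> carrier R" using U by auto
  have "(y \<ominus> \<one>) \<otimes> z = y \<otimes> z \<ominus> z" using c by (simp add: a_minus_def l_distr l_minus)
  moreover have "y = y \<otimes> z \<otimes> inv z" using c U by (simp add: m_assoc)
  ultimately have "a = (y \<otimes> z, y \<otimes> z) \<otimes>\<^bsub>add_units_group R\<^esub> inv\<^bsub>add_units_group R\<^esub> (z, z)"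
    using a c U by (simp add: add_units_group_div)
  then show "\<exists>x\<in>{(x, x) |x. x \<in> Units R}. \<exists>y\<in>{(x, x) |x. x \<in> Units R}.
      a = x \<otimes>\<^bsub>add_units_group R\<^esub> inv\<^bsub>add_units_group R\<^esub> y"
    using U c by blast
qed

text \<open>A left inverse makes left multiplication by x injective, hence surjective on a finite
  carrier; a preimage of the identity is a right inverse.\<close>

lemma (in monoid) Units_if_left_inverse:
  assumes "finite (carrier G)" "x \<in> carrier G" "y \<in> carrier G" "y \<otimes> x = \<one>"
  shows "x \<in> Units G"
proof -
  have "inj_on (\<lambda>r. x \<otimes> r) (carrier G)"
  proof (rule inj_onI)
    fix r s assume rs: "r \<in> carrier G" "s \<in> carrier G" "x \<otimes> r = x \<otimes> s"
    then have "y \<otimes> x \<otimes> r = y \<otimes> x \<otimes> s" by (metis assms(2,3) m_assoc)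
    then show "r = s" using assms rs by simp
  qed
  then have "(\<lambda>r. x \<otimes> r) ` carrier G = carrier G"
    using assms by (intro endo_inj_surj) auto
  then obtain z where z: "z \<in> carrier G" "x \<otimes> z = \<one>" by (metis imageE one_closed)
  then have "y = z" using assms by (metis l_one m_assoc r_one)
  then show ?thesis using assms z unfolding Units_def by blast
qed

section \<open>Maximal ideals and left ideals\<close>

context ring
begin

lemma ex_maximalideal_superset:
  assumes "finite (carrier R)" "ideal P R" "\<one> \<notin> P"
  shows "\<exists>J. maximalideal J R \<and> P \<subseteq> J"
proof -
  define \<J> where "\<J> = {J. ideal J R \<and> \<one> \<notin> J}"
  have "\<J> \<subseteq> Pow (carrier R)"
    unfolding \<J>_def using additive_subgroup.a_subset ideal_def by blast
  then have "finite \<J>" using assms finite_subset by blast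
  moreover have "P \<in> \<J>" unfolding \<J>_def using assms by simp
  ultimately obtain J where J: "J \<in> \<J>" "P \<subseteq> J" and J_max: "\<forall>N\<in>\<J>. J \<subseteq> N \<longrightarrow> J = N"
    using finite_has_maximal2[of \<J> P] by blast
  have "maximalideal J R"
  proof (rule maximalidealI)
    show "ideal J R" "carrier R \<noteq> J" using J unfolding \<J>_def by auto
    fix N assume N: "ideal N R" "J \<subseteq> N"
    then show "N = J \<or> N = carrier R"
      using J_max ideal.one_imp_carrier[OF N(1)] unfolding \<J>_def by blast
  qed
  with J show ?thesis by blast
qed

text \<open>Closure under negation is obtained by multiplying with -1.\<close>

definition left_ideal :: "'a set \<Rightarrow> bool" where
  "left_ideal L \<longleftrightarrow> L \<subseteq> carrier R \<and> \<zero> \<in> L \<and> (\<forall>a\<in>L. \<forall>b\<in>L. a \<oplus> b \<in> L) \<and>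
     (\<forall>r\<in>carrier R. \<forall>a\<in>L. r \<otimes> a \<in> L)"

lemma left_idealD:
  assumes "left_ideal L"
  shows "L \<subseteq> carrier R" "\<zero> \<in> L" "a \<in> L \<Longrightarrow> b \<in> L \<Longrightarrow> a \<oplus> b \<in> L"
    "r \<in> carrier R \<Longrightarrow> a \<in> L \<Longrightarrow> r \<otimes> a \<in> L" "a \<in> L \<Longrightarrow> b \<in> L \<Longrightarrow> a \<ominus> b \<in> L"
proof -
  show 1: "L \<subseteq> carrier R" "\<zero> \<in> L" "r \<in> carrier R \<Longrightarrow> a \<in> L \<Longrightarrow> r \<otimes> a \<in> L"
    and 2: "a \<in> L \<Longrightarrow> b \<in> L \<Longrightarrow> a \<oplus> b \<in> L" for a b r
    using assms unfolding left_ideal_def by blast+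
  show "a \<ominus> b \<in> L" if "a \<in> L" "b \<in> L"
  proof -
    have "b \<in> carrier R" using that 1 by blast
    then have "\<ominus> b = (\<ominus> \<one>) \<otimes> b" by (simp add: l_minus)
    then have "\<ominus> b \<in> L" using 1(3)[of "\<ominus> \<one>" b] that by simp
    then show ?thesis unfolding a_minus_def using that 2 by blast
  qed
qed

lemma ideal_imp_left_ideal: "ideal J R \<Longrightarrow> left_ideal J"
  unfolding left_ideal_def
  by (meson additive_subgroup.a_closed additive_subgroup.a_subset additive_subgroup.zero_closed
      ideal.I_l_closed ideal_def)

text \<open>Serves both the principal left ideal R t, with zero for \<open>L\<close>, and the sums A
  t + L of the density argument.\<close>

lemma left_ideal_add_mult:
  assumes "left_ideal A" "left_ideal L" "t \<in> carrier R"
  shows "left_ideal {a \<otimes> t \<oplus> l |a l. a \<in> A \<and> l \<in> L}" (is "left_ideal ?M")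
  unfolding left_ideal_def
proof (intro conjI ballI)
  note A = left_idealD[OF assms(1)] and L = left_idealD[OF assms(2)]
  have M: "a \<otimes> t \<oplus> l \<in> ?M" if "a \<in> A" "l \<in> L" for a l using that by blast
  have c: "a \<in> carrier R" "l \<in> carrier R" if "a \<in> A" "l \<in> L" for a l
    using that A(1) L(1) by auto
  show "\<zero> \<in> ?M" using M[OF A(2) L(2)] assms(3) by simp
  show "?M \<subseteq> carrier R" using c assms(3) by auto
  show "u \<oplus> v \<in> ?M" if "u \<in> ?M" "v \<in> ?M" for u v
  proof -
    obtain a l b m where u: "a \<in> A" "l \<in> L" "u = a \<otimes> t \<oplus> l"
      and v: "b \<in> A" "m \<in> L" "v = b \<otimes> t \<oplus> m" using \<open>u \<in> ?M\<close> \<open>v \<in> ?M\<close> by blast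
    have "u \<oplus> v = (a \<oplus> b) \<otimes> t \<oplus> (l \<oplus> m)"
      unfolding u(3) v(3) using c[OF u(1,2)] c[OF v(1,2)] assms(3) by (simp add: l_distr a_ac)
    also have "\<dots> \<in> ?M" using u v by (intro M A(3) L(3))
    finally show ?thesis .
  qed
  show "r \<otimes> u \<in> ?M" if "r \<in> carrier R" "u \<in> ?M" for r u
  proof -
    obtain a l where u: "a \<in> A" "l \<in> L" "u = a \<otimes> t \<oplus> l" using \<open>u \<in> ?M\<close> by blast
    have "r \<otimes> u = (r \<otimes> a) \<otimes> t \<oplus> r \<otimes> l"
      unfolding u(3) using c[OF u(1,2)] that(1) assms(3) by (simp add: r_distr m_assoc)
    also have "\<dots> \<in> ?M" using u that(1) by (intro M A(4) L(4))
    finally show ?thesis .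
  qed
qed

end

text \<open>In a noncommutative ring the quotient by a maximal two-sided ideal is simple but may
  fail to be a field, so \<open>quotient_field\<close> is assumed.\<close>

locale finite_local_ring = ring R for R (structure) +
  fixes I
  assumes finite_carrier: "finite (carrier R)"
    and maximal: "maximalideal I R"
    and unique: "\<And>J. maximalideal J R \<Longrightarrow> J = I"
    and quotient_field: "field (R Quot I)"
begin

interpretation I: maximalideal I R by (rule maximal)

lemma one_notin: "\<one> \<notin> I"
  using I.I_notcarr I.one_imp_carrier by blast

text \<open>A density argument for the simple left module R/L. By hypothesis x acts as the identity
  on the class of 1; the y sought acts as the identity on the classes of all of \<open>S\<close>.
  For each new t, y is corrected by an element of \<open>I\<close> that kills the earlier
  classes.\<close>

lemma maximal_left_ideal_annihilated:
  assumes x: "x \<in> I" "\<one> \<ominus> x \<in> L" and L: "left_ideal L" "\<one> \<notin> L"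
    and L_max: "\<And>N. \<lbrakk>left_ideal N; L \<subseteq> N; \<one> \<notin> N\<rbrakk> \<Longrightarrow> N = L"
    and S: "finite S" "S \<subseteq> carrier R"
  shows "\<exists>y\<in>I. \<forall>s\<in>S. (\<one> \<ominus> y) \<otimes> s \<in> L"
  using S
proof (induction S rule: finite_induct)
  case empty
  then show ?case using I.zero_closed by blast
next
  case (insert t S)
  note LD = left_idealD[OF L(1)]
  have t: "t \<in> carrier R" and S: "S \<subseteq> carrier R" using insert by auto
  obtain y where y: "y \<in> I" "\<And>s. s \<in> S \<Longrightarrow> (\<one> \<ominus> y) \<otimes> s \<in> L" using insert by auto
  have yc: "y \<in> carrier R" "x \<in> carrier R" using y x I.Icarr by auto
  \<comment> \<open>The annihilator of the classes of \<open>S\<close> in R/L.\<close>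
  define A where "A = {r \<in> carrier R. \<forall>s\<in>S. r \<otimes> s \<in> L}"
  have A: "left_ideal A"
    unfolding left_ideal_def A_def using LD S
    by (auto simp: l_distr m_assoc subset_iff)
  \<comment> \<open>By maximality of \<open>L\<close>, the left ideal A' t + L is the whole ring as
    soon as it exceeds \<open>L\<close>.\<close>
  have span: "\<exists>a\<in>A'. \<exists>l\<in>L. \<one> = a \<otimes> t \<oplus> l"
    if A': "left_ideal A'" and a: "a \<in> A'" "a \<otimes> t \<notin> L" for A' a
  proof -
    let ?N = "{a \<otimes> t \<oplus> l |a l. a \<in> A' \<and> l \<in> L}"
    note A'D = left_idealD[OF A']
    have N: "a \<otimes> t \<oplus> l \<in> ?N" if "a \<in> A'" "l \<in> L" for a l using that by blast
    have "L \<subseteq> ?N"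
    proof
      fix l assume "l \<in> L"
      moreover have "l \<in> carrier R" using \<open>l \<in> L\<close> LD(1) by blast
      ultimately show "l \<in> ?N" using N[OF A'D(2), of l] t by simp
    qed
    moreover have "a \<otimes> t \<in> ?N"
    proof -
      have "a \<in> carrier R" using a A'D(1) by blast
      then show ?thesis using N[OF a(1) LD(2)] t by simp
    qed
    ultimately have N: "L \<subseteq> ?N" "a \<otimes> t \<in> ?N" by blast+
    show ?thesis
    proof (rule ccontr)
      assume "\<not> ?thesis"
      then have "\<one> \<notin> ?N" by blast
      then have "?N = L" using L_max[OF left_ideal_add_mult[OF A' L(1) t] N(1)] by blast
      then show False using N(2) a(2) by blast
    qed
  qed
  show ?case
  proof (cases "\<forall>a\<in>A. a \<otimes> t \<in> L")
    case True
    moreover have "\<one> \<ominus> y \<in> A" unfolding A_def using y yc by auto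
    ultimately show ?thesis using y by blast
  next
    case False
    then obtain b l where b: "b \<in> A" "l \<in> L" "\<one> = b \<otimes> t \<oplus> l" using span A by blast
    have bc: "b \<in> carrier R" "l \<in> carrier R" using b A LD unfolding A_def by auto
    \<comment> \<open>Multiplying b by x moves it into \<open>I\<close>, and x outside
      \<open>L\<close> keeps (x b) t outside \<open>L\<close>. So \<open>span\<close> applies to the
      intersection of \<open>A\<close> and \<open>I\<close> as well.\<close>
    have "x \<notin> L"
    proof
      assume "x \<in> L"
      then have "(\<one> \<ominus> x) \<oplus> x \<in> L" using x LD by blast
      then show False using L yc by (simp add: a_minus_def a_assoc l_neg)
    qed
    have "x = x \<otimes> (b \<otimes> t \<oplus> l)" unfolding b(3)[symmetric] using yc by simp
    also have "\<dots> = (x \<otimes> b) \<otimes> t \<oplus> x \<otimes> l" using yc bc t by (simp add: r_distr m_assoc)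
    finally have xbt: "x = (x \<otimes> b) \<otimes> t \<oplus> x \<otimes> l" .
    have "(x \<otimes> b) \<otimes> t \<notin> L"
    proof
      assume "(x \<otimes> b) \<otimes> t \<in> L"
      from LD(3)[OF this LD(4)[OF yc(2) b(2)]] show False
        unfolding xbt[symmetric] using \<open>x \<notin> L\<close> by contradiction
    qed
    moreover have "x \<otimes> b \<in> A \<inter> I"
      using left_idealD(4)[OF A] b yc x bc I.I_r_closed by blast
    moreover have AI: "left_ideal (A \<inter> I)"
      using A ideal_imp_left_ideal[OF I.is_ideal] unfolding left_ideal_def by blast
    ultimately obtain z l' where z: "z \<in> A \<inter> I" "l' \<in> L" "\<one> = z \<otimes> t \<oplus> l'"
      using span by blast
    have zc: "z \<in> carrier R" "l' \<in> carrier R" using z LD I.Icarr by auto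
    \<comment> \<open>Modulo \<open>L\<close>, z t is 1, so w t agrees with (1 - y) t while w kills
      \<open>S\<close>. Hence y + w handles t and \<open>S\<close> together.\<close>
    define w where "w = ((\<one> \<ominus> y) \<otimes> t) \<otimes> z"
    have w: "w \<in> A \<inter> I" unfolding w_def using left_idealD(4)[OF AI] z(1) yc t by simp
    then have wc: "w \<in> carrier R" using I.Icarr by blast
    have expand: "(\<one> \<ominus> (y \<oplus> w)) \<otimes> s = (\<one> \<ominus> y) \<otimes> s \<ominus> w \<otimes> s" if "s \<in> carrier R" for s
      using yc wc that by (simp add: a_minus_def l_distr minus_add l_minus a_assoc)
    have minus: "v \<ominus> p = m" if "v = p \<oplus> m" "p \<in> carrier R" "m \<in> carrier R" for v p m
      unfolding that(1) using that(2,3) by (simp add: a_minus_def a_ac r_neg r_neg2)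
    have "(\<one> \<ominus> y) \<otimes> t = (\<one> \<ominus> y) \<otimes> t \<otimes> (z \<otimes> t \<oplus> l')"
      unfolding z(3)[symmetric] using yc t by simp
    also have "\<dots> = w \<otimes> t \<oplus> ((\<one> \<ominus> y) \<otimes> t) \<otimes> l'"
      unfolding w_def using yc t zc by (simp add: r_distr m_assoc)
    finally have "(\<one> \<ominus> y) \<otimes> t \<ominus> w \<otimes> t = ((\<one> \<ominus> y) \<otimes> t) \<otimes> l'"
      using yc wc t zc by (intro minus) auto
    then have "(\<one> \<ominus> (y \<oplus> w)) \<otimes> t \<in> L" using expand t LD z(2) yc by simp
    moreover have "(\<one> \<ominus> (y \<oplus> w)) \<otimes> s \<in> L" if "s \<in> S" for s
      using expand[of s] that S y(2)[OF that] w LD unfolding A_def by auto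
    moreover have "y \<oplus> w \<in> I" using y w I.a_closed by blast
    ultimately show ?thesis by blast
  qed
qed

lemma one_minus_in_Units:
  assumes x: "x \<in> I"
  shows "\<one> \<ominus> x \<in> Units R"
proof (rule ccontr)
  assume nu: "\<one> \<ominus> x \<notin> Units R"
  have xc: "x \<in> carrier R" using x I.Icarr by blast
  \<comment> \<open>The left ideal generated by 1 - x: it is proper, since otherwise 1 - x would
    have a left inverse, and it extends to a maximal left ideal \<open>L\<close>.\<close>
  define L0 where "L0 = {a \<otimes> (\<one> \<ominus> x) \<oplus> l |a l. a \<in> carrier R \<and> l \<in> {\<zero>}}"
  have "left_ideal (carrier R)" "left_ideal {\<zero>}" unfolding left_ideal_def by auto
  then have 1: "left_ideal L0" unfolding L0_def using xc by (intro left_ideal_add_mult) auto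
  have 2: "\<one> \<notin> L0"
  proof
    assume "\<one> \<in> L0"
    then obtain a where "a \<in> carrier R" "\<one> = a \<otimes> (\<one> \<ominus> x) \<oplus> \<zero>" unfolding L0_def by blast
    then show False using nu Units_if_left_inverse[OF finite_carrier] xc by simp
  qed
  define \<L> where "\<L> = {L. left_ideal L \<and> \<one> \<notin> L}"
  have "finite \<L>"
    by (rule finite_subset[of _ "Pow (carrier R)"])
      (auto simp: \<L>_def left_ideal_def finite_carrier)
  moreover have "L0 \<in> \<L>" unfolding \<L>_def using 1 2 by simp
  ultimately obtain L where "L \<in> \<L>" "L0 \<subseteq> L" and "\<forall>N\<in>\<L>. L \<subseteq> N \<longrightarrow> L = N"
    using finite_has_maximal2[of \<L> L0] by blast
  then have L: "left_ideal L" "\<one> \<notin> L" "L0 \<subseteq> L"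
    and L_max: "\<And>N. \<lbrakk>left_ideal N; L \<subseteq> N; \<one> \<notin> N\<rbrakk> \<Longrightarrow> N = L"
    unfolding \<L>_def by auto
  have "\<one> \<ominus> x = \<one> \<otimes> (\<one> \<ominus> x) \<oplus> \<zero>" using xc by simp
  then have "\<one> \<ominus> x \<in> L0" unfolding L0_def by blast
  then have xL: "\<one> \<ominus> x \<in> L" using L by blast
  obtain y where y: "y \<in> I" "\<forall>s\<in>carrier R. (\<one> \<ominus> y) \<otimes> s \<in> L"
    using maximal_left_ideal_annihilated[OF x xL L(1,2) L_max finite_carrier] by blast
  \<comment> \<open>The annihilator of R/L is two-sided and proper, hence inside \<open>I\<close>;
    as it contains 1 - y, it forces 1 into \<open>I\<close>.\<close>
  define P where "P = {r \<in> carrier R. \<forall>s\<in>carrier R. r \<otimes> s \<in> L}"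
  have yc: "y \<in> carrier R" using y I.Icarr by blast
  note LD = left_idealD[OF L(1)]
  have PL: "left_ideal P" unfolding left_ideal_def P_def using LD
    by (auto simp: l_distr m_assoc)
  have "ideal P R"
  proof (rule idealI)
    show "subgroup P (add_monoid R)"
    proof (rule add.subgroupI)
      fix a assume a: "a \<in> P"
      then have "\<zero> \<ominus> a \<in> P" using left_idealD[OF PL] by blast
      moreover have "a \<in> carrier R" using a left_idealD[OF PL] by blast
      ultimately show "\<ominus> a \<in> P" by (simp add: a_minus_def)
    qed (use left_idealD[OF PL] in auto)
    fix a r assume "a \<in> P" "r \<in> carrier R"
    then show "r \<otimes> a \<in> P" "a \<otimes> r \<in> P"
      using left_idealD[OF PL] unfolding P_def by (auto simp: m_assoc)
  qed (rule ring_axioms)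
  moreover have "\<one> \<notin> P" unfolding P_def using L by force
  ultimately have "P \<subseteq> I" using ex_maximalideal_superset[OF finite_carrier] unique by blast
  moreover have "\<one> \<ominus> y \<in> P" unfolding P_def using y yc by auto
  ultimately have "(\<one> \<ominus> y) \<oplus> y \<in> I" using y I.a_closed by blast
  then show False using one_notin yc by (simp add: a_minus_def a_assoc l_neg)
qed

lemma commutator_in:
  assumes "a \<in> carrier R" "b \<in> carrier R"
  shows "a \<otimes> b \<ominus> b \<otimes> a \<in> I"
proof -
  interpret F: field "R Quot I" by (rule quotient_field)
  have "I +> a \<in> carrier (R Quot I)" "I +> b \<in> carrier (R Quot I)"
    using assms by (simp_all add: FactRing_def a_rcosetsI I.a_subset)
  from F.m_comm[OF this] have "I +> (a \<otimes> b) = I +> (b \<otimes> a)"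
    using assms by (simp add: FactRing_def I.rcoset_mult_add)
  then show ?thesis using assms quotient_eq_iff_same_a_r_cos[OF I.is_ideal] by simp
qed

text \<open>For u outside \<open>I\<close>, an inverse in the residue field lifts to s with 1 - s u
  in \<open>I\<close>. Then s u is a unit, so u has a left inverse, and finiteness makes u a
  unit.\<close>

lemma Units_eq: "Units R = carrier R - I"
proof (intro equalityI subsetI)
  fix u assume "u \<in> Units R"
  then have "u \<in> I \<Longrightarrow> \<one> \<in> I" using I.I_l_closed[of u "inv u"] by simp
  then show "u \<in> carrier R - I" using \<open>u \<in> Units R\<close> one_notin by auto
next
  fix u assume u: "u \<in> carrier R - I"
  interpret F: field "R Quot I" by (rule quotient_field)
  have "I +> u \<in> carrier (R Quot I)" using u by (simp add: FactRing_def a_rcosetsI I.a_subset)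
  moreover have "I +> u \<noteq> I" using u a_rcos_zero[OF I.is_ideal] I.a_rcos_self by auto
  ultimately have "I +> u \<in> Units (R Quot I)"
    using F.field_Units by (auto simp: FactRing_def)
  then obtain c where "c \<in> carrier (R Quot I)" "c \<otimes>\<^bsub>R Quot I\<^esub> (I +> u) = \<one>\<^bsub>R Quot I\<^esub>"
    using F.Units_l_inv_ex by blast
  then obtain s where s: "s \<in> carrier R" "(I +> s) \<otimes>\<^bsub>R Quot I\<^esub> (I +> u) = \<one>\<^bsub>R Quot I\<^esub>"
    by (auto simp: FactRing_simps)
  then have "I +> (s \<otimes> u) = I +> \<one>"
    using u by (simp add: FactRing_def I.rcoset_mult_add)
  then have "I +> \<one> = I +> (s \<otimes> u)" by simp
  then have "\<one> \<ominus> s \<otimes> u \<in> I" using u s quotient_eq_iff_same_a_r_cos[OF I.is_ideal] by simp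
  then have "\<one> \<ominus> (\<one> \<ominus> s \<otimes> u) \<in> Units R" by (rule one_minus_in_Units)
  moreover have "\<one> \<ominus> (\<one> \<ominus> s \<otimes> u) = s \<otimes> u"
    using u s by (simp add: a_minus_def minus_add a_assoc[symmetric] r_neg)
  ultimately have su: "s \<otimes> u \<in> Units R" by simp
  then have "(inv (s \<otimes> u) \<otimes> s) \<otimes> u = \<one>" using u s by (simp add: m_assoc)
  then show "u \<in> Units R"
    by (rule Units_if_left_inverse[OF finite_carrier, rotated 2]) (use u s su in auto)
qed

subsection \<open>Cyclic towers in the product of a local ring and its units\<close>

interpretation G: group "add_units_group R" by (rule group_add_units_group)

lemma mem_one_l_coset_iff:
  assumes "K \<subseteq> carrier R"
  shows "u \<in> \<one> <+ K \<longleftrightarrow> u \<in> carrier R \<and> u \<ominus> \<one> \<in> K"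
proof
  assume "u \<in> \<one> <+ K"
  then obtain k where k: "k \<in> K" "u = \<one> \<oplus> k" by (auto simp: a_l_coset_def l_coset_def)
  moreover have "k \<in> carrier R" using k assms by blast
  ultimately have "u \<ominus> \<one> = k" by (simp add: a_minus_def a_ac r_neg r_neg2)
  then show "u \<in> carrier R \<and> u \<ominus> \<one> \<in> K" using k assms by auto
next
  assume u: "u \<in> carrier R \<and> u \<ominus> \<one> \<in> K"
  then have "u = \<one> \<oplus> (u \<ominus> \<one>)" by (auto simp: a_minus_def a_ac r_neg r_neg2)
  then show "u \<in> \<one> <+ K" using u by (auto simp: a_l_coset_def l_coset_def)
qed

lemma card_one_l_coset:
  assumes "K \<subseteq> carrier R"
  shows "card (\<one> <+ K) = card K"
proof -
  have "\<one> <+ K = (\<lambda>k. \<one> \<oplus> k) ` K" by (auto simp: a_l_coset_def l_coset_def)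
  moreover have "inj_on (\<lambda>k. \<one> \<oplus> k) K" using assms by (intro inj_onI) (meson add.l_cancel one_closed subsetD)
  ultimately show ?thesis by (simp add: card_image)
qed

lemma one_l_coset_subset_Units:
  assumes "K \<subseteq> I"
  shows "\<one> <+ K \<subseteq> Units R"
proof
  fix u assume "u \<in> \<one> <+ K"
  then have u: "u \<in> carrier R" "u \<ominus> \<one> \<in> I"
    using assms I.a_subset mem_one_l_coset_iff[of K u] by auto
  have "u \<notin> I"
  proof
    assume "u \<in> I"
    then have "u \<ominus> (u \<ominus> \<one>) \<in> I"
      by (intro left_idealD(5)[OF ideal_imp_left_ideal[OF I.is_ideal]] u)
    moreover have "u \<ominus> (u \<ominus> \<one>) = \<one>" using u by (simp add: a_minus_def minus_add r_neg2)
    ultimately show False using one_notin by simp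
  qed
  then show "u \<in> Units R" using u Units_eq by blast
qed

text \<open>For the product closure of 1 + K: both summands lie in the ideal \<open>K\<close> once u
  - 1 and v - 1 do.\<close>

lemma mult_minus_one:
  assumes "u \<in> carrier R" "v \<in> carrier R"
  shows "u \<otimes> v \<ominus> \<one> = (u \<ominus> \<one>) \<otimes> v \<oplus> (v \<ominus> \<one>)"
  using assms by (simp add: a_minus_def l_distr l_minus a_assoc[symmetric]) (simp add: a_assoc l_neg)

lemma subgroup_one_l_coset:
  assumes K: "ideal K R" "K \<subseteq> I"
  shows "subgroup (\<one> <+ K) (units_of R)"
proof -
  interpret K: ideal K R by fact
  note mem = mem_one_l_coset_iff[OF K.a_subset]
  interpret U: group "units_of R" by (rule units_group)
  have UK: "\<one> <+ K \<subseteq> Units R" using K one_l_coset_subset_Units by blast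
  show ?thesis
  proof (rule U.subgroupI)
    show "\<one> <+ K \<subseteq> carrier (units_of R)" using UK by (simp add: units_of_carrier)
    have "\<one> \<in> \<one> <+ K" using mem[of \<one>] K.zero_closed by (simp add: a_minus_def r_neg)
    then show "\<one> <+ K \<noteq> {}" by blast
    fix u assume u: "u \<in> \<one> <+ K"
    then have uU: "u \<in> Units R" using UK by blast
    have uc: "u \<in> carrier R" "u \<ominus> \<one> \<in> K" using u mem by auto
    have "inv u \<otimes> (\<ominus> (u \<ominus> \<one>)) \<in> K" using uU uc K.I_l_closed K.a_inv_closed by simp
    also have "inv u \<otimes> (\<ominus> (u \<ominus> \<one>)) = inv u \<ominus> \<one>"
      using uU uc by (simp add: a_minus_def minus_add r_distr r_minus a_ac)
    finally have "inv u \<in> \<one> <+ K" using mem uU by simp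
    then show "inv\<^bsub>units_of R\<^esub> u \<in> \<one> <+ K" using uU by (simp add: units_of_inv)
    fix v assume v: "v \<in> \<one> <+ K"
    then have vc: "v \<in> carrier R" "v \<ominus> \<one> \<in> K" using mem by auto
    have "u \<otimes> v \<ominus> \<one> \<in> K"
      unfolding mult_minus_one[OF uc(1) vc(1)] using uc vc K.I_r_closed K.a_closed by blast
    then show "u \<otimes>\<^bsub>units_of R\<^esub> v \<in> \<one> <+ K" using mem uc vc by (simp add: units_of_mult)
  qed
qed

text \<open>Addition commutes, so a commutator in the product group has first component zero, and
  only the commutators of \<open>V\<close> have to be controlled.\<close>

lemma cyclic_tower_Times:
  assumes S: "subgroup S (add_monoid R)" and V: "subgroup V (units_of R)"
    and tower: "G.cyclic_tower (Y \<times> W)" and sub: "Y \<subseteq> S" "W \<subseteq> V" "\<zero> \<in> Y"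
    and comm: "\<And>u v. \<lbrakk>u \<in> V; v \<in> V\<rbrakk> \<Longrightarrow> (u \<otimes> v) \<otimes> inv (v \<otimes> u) \<in> W"
  shows "G.cyclic_tower (S \<times> V)"
proof (rule G.cyclic_tower_abelian_extension[OF _ _ tower])
  show "finite (carrier (add_units_group R))"
    using finite_carrier by (auto simp: carrier_add_units_group intro: finite_subset[OF Units_closed[THEN subsetI]])
  show "subgroup (S \<times> V) (add_units_group R)"
    unfolding add_units_group_def using S V by (intro DirProd_subgroups a_group units_group)
  show "Y \<times> W \<subseteq> S \<times> V" using sub by blast
  fix p q assume "p \<in> S \<times> V" "q \<in> S \<times> V"
  then obtain a u b v where p: "p = (a, u)" "a \<in> S" "u \<in> V" and q: "q = (b, v)" "b \<in> S" "v \<in> V"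
    by blast
  have c: "a \<in> carrier R" "b \<in> carrier R" "u \<in> Units R" "v \<in> Units R"
    using p q subgroup.subset[OF S] subgroup.subset[OF V] by (auto simp: units_of_carrier)
  have "((u \<otimes> v) \<otimes> inv (v \<otimes> u)) \<otimes> (v \<otimes> u) = u \<otimes> v"
    using c by (simp add: m_assoc Units_closed)
  then have "p \<otimes>\<^bsub>add_units_group R\<^esub> q =
      (\<zero>, (u \<otimes> v) \<otimes> inv (v \<otimes> u)) \<otimes>\<^bsub>add_units_group R\<^esub> (q \<otimes>\<^bsub>add_units_group R\<^esub> p)"
    using c p q by (simp add: add_units_group_def units_of_mult a_comm)
  then show "\<exists>k\<in>Y \<times> W. p \<otimes>\<^bsub>add_units_group R\<^esub> q =
      k \<otimes>\<^bsub>add_units_group R\<^esub> (q \<otimes>\<^bsub>add_units_group R\<^esub> p)"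
    using sub comm[OF p(3) q(3)] by blast
qed

text \<open>Transfers membership of u v - v u in an ideal \<open>K\<close> to membership of the
  group commutator in 1 + K.\<close>

lemma group_commutator_minus_one:
  assumes "u \<in> Units R" "v \<in> Units R"
  shows "(u \<otimes> v) \<otimes> inv (v \<otimes> u) \<ominus> \<one> = (u \<otimes> v \<ominus> v \<otimes> u) \<otimes> inv (v \<otimes> u)"
  using assms by (simp add: a_minus_def l_distr l_minus Units_closed)

text \<open>Subtracting the central element 1 does not change commutators; for u, v in 1 + K the
  right side consists of products of two elements of \<open>K\<close>.\<close>

lemma ring_commutator_shift:
  assumes "u \<in> carrier R" "v \<in> carrier R"
  shows "u \<otimes> v \<ominus> v \<otimes> u
    = (u \<ominus> \<one>) \<otimes> (v \<ominus> \<one>) \<ominus> (v \<ominus> \<one>) \<otimes> (u \<ominus> \<one>)"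
proof -
  \<comment> \<open>The part common to both expanded products.\<close>
  define c where "c = \<one> \<ominus> (u \<oplus> v)"
  have c: "c \<in> carrier R" using assms unfolding c_def by simp
  have "(u \<ominus> \<one>) \<otimes> (v \<ominus> \<one>) = u \<otimes> v \<oplus> c"
    using assms unfolding c_def
    by (simp add: a_minus_def l_distr r_distr l_minus r_minus minus_add a_ac)
  moreover have "(v \<ominus> \<one>) \<otimes> (u \<ominus> \<one>) = v \<otimes> u \<oplus> c"
    using assms unfolding c_def
    by (simp add: a_minus_def l_distr r_distr l_minus r_minus minus_add a_ac)
  moreover have "(x \<oplus> c) \<ominus> (y \<oplus> c) = x \<ominus> y" if "x \<in> carrier R" "y \<in> carrier R" for x y
  proof -
    have "(x \<oplus> c) \<ominus> (y \<oplus> c) = x \<oplus> (c \<oplus> (\<ominus> c \<oplus> \<ominus> y))"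
      using that c by (simp add: a_minus_def a_assoc minus_add a_comm[of "\<ominus> y"])
    then show ?thesis using that c by (simp add: a_minus_def r_neg2)
  qed
  ultimately show ?thesis using assms by simp
qed

text \<open>The ascending annihilator chain of the nilpotent ideal \<open>I\<close> replaces its powers.\<close>

lemma ideal_colon:
  assumes K: "ideal K R" "K \<subseteq> I"
  defines "K' \<equiv> {a \<in> I. \<forall>x\<in>I. a \<otimes> x \<in> K}"
  shows "ideal K' R" "K \<subseteq> K'" "K \<noteq> I \<Longrightarrow> K' \<noteq> K"
proof -
  interpret K: ideal K R by fact
  have D: "a \<in> I" "a \<in> carrier R" "x \<in> I \<Longrightarrow> a \<otimes> x \<in> K" if "a \<in> K'" for a x
    using that I.Icarr unfolding K'_def by blast+
  have K'I: "a \<in> K'" if "a \<in> I" "\<And>x. \<lbrakk>x \<in> I; x \<in> carrier R\<rbrakk> \<Longrightarrow> a \<otimes> x \<in> K" for a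
    using that I.Icarr unfolding K'_def by blast
  show "ideal K' R"
  proof (rule idealI)
    show "subgroup K' (add_monoid R)"
    proof (rule add.subgroupI)
      show "K' \<subseteq> carrier R" using D(2) by blast
      have "\<zero> \<in> K'" by (rule K'I) simp_all
      then show "K' \<noteq> {}" by blast
      show "\<ominus> a \<in> K'" if "a \<in> K'" for a
        using D[OF that] by (intro K'I) (simp_all add: l_minus)
      show "a \<oplus> b \<in> K'" if "a \<in> K'" "b \<in> K'" for a b
        using D[OF that(1)] D[OF that(2)] by (intro K'I) (simp_all add: l_distr)
    qed
    fix a r assume a: "a \<in> K'" and r: "r \<in> carrier R"
    show "r \<otimes> a \<in> K'"
      using D[OF a] r by (intro K'I) (simp_all add: m_assoc I.I_l_closed K.I_l_closed)
    show "a \<otimes> r \<in> K'"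
      using D[OF a] r by (intro K'I) (simp_all add: m_assoc I.I_l_closed I.I_r_closed)
  qed (rule ring_axioms)
  show "K \<subseteq> K'"
  proof
    fix a assume a: "a \<in> K"
    show "a \<in> K'"
      by (rule K'I[OF subsetD[OF K(2) a] K.I_r_closed[OF a]])
  qed
  show "K' \<noteq> K" if ne: "K \<noteq> I"
  proof
    assume eq: "K' = K"
    \<comment> \<open>The size of the right ideal a R, minimized over a in \<open>I\<close> outside
      \<open>K\<close>. If K' were \<open>K\<close>, some a x would also lie outside
      \<open>K\<close>, and minimality would give a x R = a R.\<close>
    define m where "m a = card ((\<lambda>r. a \<otimes> r) ` carrier R)" for a
    obtain a0 where "a0 \<in> I - K" using ne K(2) by blast
    from ex_has_least_nat[of "\<lambda>a. a \<in> I - K", OF this, of m]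
    obtain a where a: "a \<in> I - K" and a_min: "\<And>b. b \<in> I - K \<Longrightarrow> m a \<le> m b" by blast
    have ac: "a \<in> carrier R" using a I.Icarr by blast
    obtain x where x: "x \<in> I" "a \<otimes> x \<notin> K" using a eq unfolding K'_def by blast
    have xc: "x \<in> carrier R" using x I.Icarr by blast
    have sub: "(\<lambda>r. (a \<otimes> x) \<otimes> r) ` carrier R \<subseteq> (\<lambda>r. a \<otimes> r) ` carrier R"
      using ac xc by (auto simp: m_assoc)
    have "a \<otimes> x \<in> I - K" using a x xc I.I_r_closed by blast
    then have "(\<lambda>r. (a \<otimes> x) \<otimes> r) ` carrier R = (\<lambda>r. a \<otimes> r) ` carrier R"
      using a_min finite_carrier unfolding m_def by (intro card_subset_eq sub) (auto intro: antisym card_mono[OF _ sub])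
    moreover have "a \<in> (\<lambda>r. a \<otimes> r) ` carrier R"
      by (rule image_eqI[of _ _ \<one>]) (use ac in simp_all)
    ultimately have "a \<in> (\<lambda>r. (a \<otimes> x) \<otimes> r) ` carrier R" by simp
    then obtain r where r: "r \<in> carrier R" "a = (a \<otimes> x) \<otimes> r" by blast
    \<comment> \<open>From a = a x r follows a (1 - x r) = 0, and cancelling the unit puts a = 0
      into \<open>K\<close>.\<close>
    have xr: "\<one> \<ominus> x \<otimes> r \<in> Units R" using x r I.I_r_closed one_minus_in_Units by blast
    have "a \<otimes> (\<one> \<ominus> x \<otimes> r) = a \<ominus> (a \<otimes> x) \<otimes> r"
      using ac xc r(1) by (simp add: a_minus_def r_distr r_minus m_assoc)
    also have "\<dots> = \<zero>" unfolding r(2)[symmetric] using ac by (simp add: a_minus_def r_neg)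
    finally have "a \<otimes> (\<one> \<ominus> x \<otimes> r) \<otimes> inv (\<one> \<ominus> x \<otimes> r) = \<zero>" using xr by simp
    then have "a = \<zero>" using ac xr by (simp add: m_assoc Units_closed)
    then show False using a K.zero_closed by blast
  qed
qed

text \<open>Products of elements of K' with elements of \<open>I\<close> fall into \<open>K\<close>,
  so the commutators of 1 + K' lie in 1 + K. The ideals grow strictly until they reach
  \<open>I\<close>.\<close>

lemma cyclic_tower_one_l_coset_extend:
  assumes S: "subgroup S (add_monoid R)"
    and "ideal K R" "K \<subseteq> I" "G.cyclic_tower (S \<times> (\<one> <+ K))"
  shows "G.cyclic_tower (S \<times> (\<one> <+ I))"
  using assms(2-)
proof (induction "card I - card K" arbitrary: K rule: less_induct)
  case less
  show ?case
  proof (cases "K = I")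
    case True
    then show ?thesis using less by simp
  next
    case False
    define K' where "K' = {a \<in> I. \<forall>x\<in>I. a \<otimes> x \<in> K}"
    note K' = ideal_colon[OF less.prems(1,2), folded K'_def]
    have KK: "K \<subset> K'" using K'(2) K'(3)[OF False] by blast
    have K'I: "K' \<subseteq> I" unfolding K'_def by blast
    interpret K: ideal K R by (rule less.prems(1))
    interpret K': ideal K' R by (rule K'(1))
    note mem = mem_one_l_coset_iff[OF K.a_subset] and mem' = mem_one_l_coset_iff[OF K'.a_subset]
    have tower: "G.cyclic_tower (S \<times> (\<one> <+ K'))"
    proof (rule cyclic_tower_Times[OF S subgroup_one_l_coset[OF K'(1) K'I] less.prems(3)])
      show "\<one> <+ K \<subseteq> \<one> <+ K'" using K'(2) mem mem' by blast
      show "\<zero> \<in> S" using subgroup.one_closed[OF S] by simp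
      fix u v assume uv: "u \<in> \<one> <+ K'" "v \<in> \<one> <+ K'"
      then have U: "u \<in> Units R" "v \<in> Units R" using one_l_coset_subset_Units[OF K'I] by auto
      have c: "u \<in> carrier R" "v \<in> carrier R" "u \<ominus> \<one> \<in> K'" "v \<ominus> \<one> \<in> K'" using uv mem' by auto
      then have "(u \<ominus> \<one>) \<otimes> (v \<ominus> \<one>) \<in> K" "(v \<ominus> \<one>) \<otimes> (u \<ominus> \<one>) \<in> K" unfolding K'_def by auto
      then have "u \<otimes> v \<ominus> v \<otimes> u \<in> K"
        unfolding ring_commutator_shift[OF c(1,2)]
        by (rule left_idealD(5)[OF ideal_imp_left_ideal[OF less.prems(1)]])
      then have "(u \<otimes> v) \<otimes> inv (v \<otimes> u) \<ominus> \<one> \<in> K"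
        unfolding group_commutator_minus_one[OF U] using U K.I_r_closed by simp
      then show "(u \<otimes> v) \<otimes> inv (v \<otimes> u) \<in> \<one> <+ K" using mem U c by simp
    qed simp
    have finI: "finite I" using I.a_subset finite_carrier finite_subset by blast
    have "card K < card K'" using finI KK K'I finite_subset psubset_card_mono by metis
    moreover have "card K' \<le> card I" using finI K'I card_mono by blast
    ultimately have "card I - card K' < card I - card K" by linarith
    then show ?thesis using less.hyps K'(1) K'I tower by blast
  qed
qed

text \<open>The tower first climbs through the abelian group S \<times> {1}, then along the ideals
  inside \<open>I\<close>.\<close>

lemma cyclic_tower_one_l_coset:
  assumes S: "subgroup S (add_monoid R)"
  shows "G.cyclic_tower (S \<times> (\<one> <+ I))"
proof -
  interpret Z: ideal "{\<zero>}" R by (rule zeroideal)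
  have sub: "{\<zero>} \<subseteq> I" using I.zero_closed by blast
  have V: "subgroup (\<one> <+ {\<zero>}) (units_of R)" using zeroideal sub by (rule subgroup_one_l_coset)
  have one: "\<one> <+ {\<zero>} = {\<one>}" by (simp add: a_l_coset_def l_coset_def)
  have "\<one>\<^bsub>add_units_group R\<^esub> = (\<zero>, \<one>)" by (simp add: add_units_group_def units_of_one)
  then have tower: "G.cyclic_tower ({\<zero>} \<times> (\<one> <+ {\<zero>}))" using G.cyclic_tower.trivial one by simp
  have "G.cyclic_tower (S \<times> (\<one> <+ {\<zero>}))"
    using subgroup.one_closed[OF S] by (intro cyclic_tower_Times[OF S V tower]) (auto simp: one)
  then show ?thesis using cyclic_tower_one_l_coset_extend[OF S zeroideal sub] by blast
qed

text \<open>On top of I \<times> (1 + I) one abelian extension suffices, because R/I is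
  commutative.\<close>

lemma cyclic_tower_ideal_Times_Units: "G.cyclic_tower (I \<times> Units R)"
proof (rule cyclic_tower_Times)
  show S: "subgroup I (add_monoid R)" by (rule I.a_subgroup)
  show "subgroup (Units R) (units_of R)"
    using group.subgroup_self[OF units_group] by (simp add: units_of_carrier)
  show "G.cyclic_tower (I \<times> (\<one> <+ I))" using S by (rule cyclic_tower_one_l_coset)
  show "\<one> <+ I \<subseteq> Units R" by (rule one_l_coset_subset_Units) simp
  show "\<zero> \<in> I" by (rule I.zero_closed)
  fix u v assume U: "u \<in> Units R" "v \<in> Units R"
  then have "u \<otimes> v \<ominus> v \<otimes> u \<in> I" using commutator_in by blast
  then have "(u \<otimes> v) \<otimes> inv (v \<otimes> u) \<ominus> \<one> \<in> I"
    unfolding group_commutator_minus_one[OF U] using U I.I_r_closed by simp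
  then show "(u \<otimes> v) \<otimes> inv (v \<otimes> u) \<in> \<one> <+ I"
    using mem_one_l_coset_iff[OF I.a_subset] U by (simp add: Units_closed)
qed simp

subsection \<open>Bounds for local rings\<close>

lemma finite_Units: "finite (Units R)"
  using finite_carrier Units_closed by (meson finite_subset subsetI)

lemma finite_I: "finite I"
  using finite_carrier I.a_subset finite_subset by blast

lemma carrier_covered:
  "carrier R \<times> Units R \<subseteq>
    {(x, y). x \<in> carrier R \<and> y \<in> Units R \<and> (\<exists>z\<in>Units R. (y \<ominus> \<one>) \<otimes> z = x)}
    \<union> I \<times> Units R \<union> carrier R \<times> (\<one> <+ I)"
proof
  fix p assume "p \<in> carrier R \<times> Units R"
  then obtain x y where p: "p = (x, y)" "x \<in> carrier R" "y \<in> Units R" by blast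
  show "p \<in> {(x, y). x \<in> carrier R \<and> y \<in> Units R \<and> (\<exists>z\<in>Units R. (y \<ominus> \<one>) \<otimes> z = x)}
    \<union> I \<times> Units R \<union> carrier R \<times> (\<one> <+ I)"
  proof (cases "x \<in> I \<or> y \<ominus> \<one> \<in> I")
    case True
    then show ?thesis using p mem_one_l_coset_iff[OF I.a_subset, of y] by auto
  next
    case False
    then have U: "x \<in> Units R" "y \<ominus> \<one> \<in> Units R" unfolding Units_eq using p by auto
    then have "(y \<ominus> \<one>) \<otimes> (inv (y \<ominus> \<one>) \<otimes> x) = x" using p
      by (simp add: m_assoc[symmetric] Units_closed)
    moreover have "inv (y \<ominus> \<one>) \<otimes> x \<in> Units R" using U by simp
    ultimately have "\<exists>z\<in>Units R. (y \<ominus> \<one>) \<otimes> z = x" by blast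
    then show ?thesis using p by simp
  qed
qed

lemma one_l_coset_I_subset: "\<one> <+ I \<subseteq> Units R"
  by (rule one_l_coset_subset_Units) simp

text \<open>The diagonal and both translated bases contain (1, 1), which is counted once instead of
  three times. Putting 2 on the left avoids truncated subtraction.\<close>

lemma difference_size_carrier_le:
  "difference_size (add_units_group R) (carrier R \<times> Units R) + 2
    \<le> card (Units R) + difference_size (add_units_group R) (I \<times> Units R)
      + difference_size (add_units_group R) (carrier R \<times> (\<one> <+ I))"
proof -
  let ?G = "add_units_group R" and ?D = "{(x, x) |x. x \<in> Units R}"
  let ?p = "(\<one>, \<one>)"
  have p: "?p \<in> carrier ?G" by (simp add: carrier_add_units_group)
  have sub: "I \<times> Units R \<subseteq> carrier ?G" "carrier R \<times> (\<one> <+ I) \<subseteq> carrier ?G"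
    using I.a_subset one_l_coset_I_subset by (auto simp: carrier_add_units_group)
  have fin: "finite (I \<times> Units R)" "finite (carrier R \<times> (\<one> <+ I))"
    using finite_I finite_Units finite_carrier finite_subset[OF one_l_coset_I_subset] by auto
  have "?p \<in> carrier R \<times> (\<one> <+ I)" "(\<zero>, \<one>) \<in> I \<times> Units R"
    using mem_one_l_coset_iff[OF I.a_subset, of \<one>] by (auto simp: a_minus_def r_neg)
  then have ne: "I \<times> Units R \<noteq> {}" "carrier R \<times> (\<one> <+ I) \<noteq> {}" by blast+
  obtain B where B: "finite B" "difference_basis ?G (I \<times> Units R) B"
    "card B = difference_size ?G (I \<times> Units R)" "?p \<in> B"
    using G.ex_minimal_difference_basis_containing[OF fin(1) sub(1) ne(1) p] by blast
  obtain C where C: "finite C" "difference_basis ?G (carrier R \<times> (\<one> <+ I)) C"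
    "card C = difference_size ?G (carrier R \<times> (\<one> <+ I))" "?p \<in> C"
    using G.ex_minimal_difference_basis_containing[OF fin(2) sub(2) ne(2) p] by blast
  have D_image: "?D = (\<lambda>x. (x, x)) ` Units R" by blast
  have D: "finite ?D" "card ?D = card (Units R)" "?p \<in> ?D"
    unfolding D_image using finite_Units by (auto intro: card_image inj_onI)
  have "difference_basis ?G (carrier R \<times> Units R) (?D \<union> B \<union> C)"
    using difference_basis_diagonal B(2) C(2) carrier_covered
    by (intro difference_basis_mono[OF difference_basis_Un[OF difference_basis_Un]])
  then have "difference_size ?G (carrier R \<times> Units R) \<le> card (?D \<union> B \<union> C)"
    using D B C by (intro difference_size_le) auto
  also have "?D \<union> B \<union> C = ?D \<union> (B - {?p}) \<union> (C - {?p})" using D(3) by blast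
  also have "card \<dots> \<le> card ?D + card (B - {?p}) + card (C - {?p})"
    by (meson add_le_mono card_Un_le le_refl order_trans)
  also have "card (B - {?p}) = card B - 1" using B by simp
  also have "card (C - {?p}) = card C - 1" using C by simp
  finally have "difference_size ?G (carrier R \<times> Units R)
      \<le> card (Units R) + (card B - 1) + (card C - 1)" using D by simp
  moreover have "0 < card B" "0 < card C" unfolding card_gt_0_iff using B C by blast+
  ultimately show ?thesis using B C by linarith
qed

section \<open>Cardinalities and numerical estimates\<close>

lemma card_carrier: "card (carrier R) = card I * card (carrier (R Quot I))"
  using a_lagrange[OF finite_carrier I.additive_subgroup_axioms]
  by (simp add: FactRing_def order_def mult.commute)

lemma card_I_pos: "0 < card I"
  unfolding card_gt_0_iff using finite_I I.zero_closed by blast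

text \<open>Makes |F| - 1 positive, so that its root may stand in a denominator.\<close>

lemma card_quotient_ge_2: "2 \<le> card (carrier (R Quot I))"
proof -
  have "card I < card (carrier R)"
    using I.a_subset I.I_notcarr finite_carrier by (intro psubset_card_mono) auto
  then have "1 < card (carrier (R Quot I))"
    unfolding card_carrier by (metis One_nat_def less_one linorder_neqE_nat mult.right_neutral
        mult_0_right not_less_zero order_less_irrefl)
  then show ?thesis by simp
qed

lemma card_Units: "real (card (Units R)) = card I * (real (card (carrier (R Quot I))) - 1)"
proof -
  have "card (Units R) = card (carrier R) - card I"
    unfolding Units_eq using finite_I I.a_subset by (intro card_Diff_subset) auto
  moreover have "card I \<le> card (carrier R)" using finite_carrier I.a_subset by (intro card_mono)
  ultimately show ?thesis using card_carrier by (simp add: of_nat_diff algebra_simps)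
qed

lemma difference_size_ideal_Times_Units:
  "difference_size (add_units_group R) (I \<times> Units R)
    \<le> 4 / sqrt 3 * (card I * sqrt (real (card (carrier (R Quot I))) - 1))"
proof -
  have "real (card (I \<times> Units R)) = (card I)\<^sup>2 * (real (card (carrier (R Quot I))) - 1)"
    by (simp add: card_cartesian_product card_Units power2_eq_square)
  then have "sqrt (card (I \<times> Units R)) = card I * sqrt (real (card (carrier (R Quot I))) - 1)"
    by (simp add: real_sqrt_mult)
  moreover have "finite (I \<times> Units R)" using finite_I finite_Units by simp
  ultimately show ?thesis
    using G.difference_size_cyclic_tower[OF _ cyclic_tower_ideal_Times_Units] by simp
qed

lemma difference_size_carrier_Times_coset:
  "difference_size (add_units_group R) (carrier R \<times> (\<one> <+ I))
    \<le> 4 / sqrt 3 * (card I * sqrt (real (card (carrier (R Quot I)))))"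
proof -
  have "real (card (carrier R \<times> (\<one> <+ I))) = (card I)\<^sup>2 * real (card (carrier (R Quot I)))"
    by (simp add: card_cartesian_product card_carrier card_one_l_coset[OF I.a_subset] power2_eq_square)
  then have "sqrt (card (carrier R \<times> (\<one> <+ I))) = card I * sqrt (card (carrier (R Quot I)))"
    by (simp add: real_sqrt_mult)
  moreover have "finite (carrier R \<times> (\<one> <+ I))"
    using finite_carrier finite_subset[OF one_l_coset_I_subset finite_Units] by simp
  moreover have "G.cyclic_tower (carrier R \<times> (\<one> <+ I))"
    using cyclic_tower_one_l_coset[OF add.subgroup_self] by simp
  ultimately show ?thesis using G.difference_size_cyclic_tower by metis
qed

text \<open>The size bound is divided by the root of |R| |U(R)|, which is i s t in the notation
  below; strictness comes from dropping the saved 2.\<close>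

lemma difference_char_carrier_less:
  "difference_char (add_units_group R) (carrier R \<times> Units R)
    < sqrt (1 - 1 / real (card (carrier (R Quot I))))
      + 4 / sqrt 3 * (1 / sqrt (real (card (carrier (R Quot I))))
                      + 1 / sqrt (real (card (carrier (R Quot I))) - 1))"
proof -
  define i f where "i = real (card I)" and "f = real (card (carrier (R Quot I)))"
  define s t where "s = sqrt f" and "t = sqrt (f - 1)"
  have pos: "0 < i" "2 \<le> f" unfolding i_def f_def using card_I_pos card_quotient_ge_2 by auto
  then have st: "0 < s" "0 < t" "f = s * s" "f - 1 = t * t" unfolding s_def t_def by auto
  have "real (card (carrier R \<times> Units R)) = i\<^sup>2 * (f * (f - 1))"
    by (simp add: card_cartesian_product card_carrier card_Units power2_eq_square i_def f_def)
  then have sq: "sqrt (card (carrier R \<times> Units R)) = i * (s * t)"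
    using pos by (simp add: real_sqrt_mult s_def t_def)
  have "real (difference_size (add_units_group R) (carrier R \<times> Units R)) + 2
      \<le> real (card (Units R)) + real (difference_size (add_units_group R) (I \<times> Units R))
        + real (difference_size (add_units_group R) (carrier R \<times> (\<one> <+ I)))"
    using difference_size_carrier_le by linarith
  also have "\<dots> \<le> i * (f - 1) + 4 / sqrt 3 * (i * t) + 4 / sqrt 3 * (i * s)"
    unfolding i_def f_def s_def t_def card_Units
    by (intro add_mono order_refl difference_size_ideal_Times_Units
        difference_size_carrier_Times_coset)
  finally have "real (difference_size (add_units_group R) (carrier R \<times> Units R))
      < i * (t * t) + 4 / sqrt 3 * (i * t) + 4 / sqrt 3 * (i * s)" using st by simp
  then have "difference_char (add_units_group R) (carrier R \<times> Units R)
      < (i * (t * t) + 4 / sqrt 3 * (i * t) + 4 / sqrt 3 * (i * s)) / (i * (s * t))"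
    unfolding difference_char_def sq using pos st by (intro divide_strict_right_mono) auto
  also have "\<dots> = t / s + 4 / sqrt 3 * (1 / s + 1 / t)"
    using pos st(1,2) by (simp add: field_simps)
  also have "t / s = sqrt (1 - 1 / f)"
  proof -
    have "1 - 1 / f = (f - 1) / f" using pos by (simp add: field_simps)
    then show ?thesis unfolding s_def t_def by (simp add: real_sqrt_divide)
  qed
  finally show ?thesis unfolding s_def t_def f_def .
qed

end

theorem theorem8p1:
  fixes R :: "('a, 'b) ring_scheme" (structure)
  assumes "ring R" and "finite (carrier R)"
  shows "difference_basis (add_units_group R)
           {(x, y). x \<in> carrier R \<and> y \<in> Units R \<and> (\<exists>z\<in>Units R. (y \<ominus> \<one>) \<otimes> z = x)}
           {(x, x) |x. x \<in> Units R}
    \<and> (\<forall>I F. local_ring R \<and> maximalideal I R \<and> F = R Quot I \<and> field F \<longrightarrow>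
        real (difference_size (add_units_group R) (carrier R \<times> Units R))
          \<le> real (card (Units R)) - 2
            + real (difference_size (add_units_group R) (I \<times> Units R))
            + real (difference_size (add_units_group R) (carrier R \<times> (\<one> <+ I)))
      \<and> real (card (Units R)) - 2
            + real (difference_size (add_units_group R) (I \<times> Units R))
            + real (difference_size (add_units_group R) (carrier R \<times> (\<one> <+ I)))
          \<le> real (card (Units R)) - 2
            + 4 / sqrt 3 * (real (card (carrier R)) / real (card (carrier F)))
              * (sqrt (real (card (carrier F)) - 1) + sqrt (real (card (carrier F))))
      \<and> difference_char (add_units_group R) (carrier R \<times> Units R)
          < sqrt (1 - 1 / real (card (carrier F)))
            + 4 / sqrt 3 * (1 / sqrt (real (card (carrier F)))
                            + 1 / sqrt (real (card (carrier F)) - 1)))"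
proof (intro conjI allI impI; (elim conjE)?)
  interpret ring R by fact
  show "difference_basis (add_units_group R)
      {(x, y). x \<in> carrier R \<and> y \<in> Units R \<and> (\<exists>z\<in>Units R. (y \<ominus> \<one>) \<otimes> z = x)}
      {(x, x) |x. x \<in> Units R}" by (rule difference_basis_diagonal)
  fix I F
  assume loc: "local_ring R" and I: "maximalideal I R" and F: "F = R Quot I" and fld: "field F"
  obtain I0 where I0: "\<And>J. maximalideal J R \<Longrightarrow> J = I0"
    using loc unfolding local_ring_def by (elim conjE ex1E) blast
  have uniq: "J = I" if "maximalideal J R" for J
    using I0[OF that] I0[OF I] by simp
  interpret finite_local_ring R I
    by (intro finite_local_ring.intro finite_local_ring_axioms.intro ring_axioms)
      (rule assms(2) I fld[unfolded F] | erule uniq)+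
  show "real (difference_size (add_units_group R) (carrier R \<times> Units R))
      \<le> real (card (Units R)) - 2
        + real (difference_size (add_units_group R) (I \<times> Units R))
        + real (difference_size (add_units_group R) (carrier R \<times> (\<one> <+ I)))"
    using difference_size_carrier_le by linarith
  have "real (card (carrier R)) / real (card (carrier F)) = card I"
    unfolding card_carrier F using card_quotient_ge_2 by simp
  then show "real (card (Units R)) - 2
        + real (difference_size (add_units_group R) (I \<times> Units R))
        + real (difference_size (add_units_group R) (carrier R \<times> (\<one> <+ I)))
      \<le> real (card (Units R)) - 2
        + 4 / sqrt 3 * (real (card (carrier R)) / real (card (carrier F)))
          * (sqrt (real (card (carrier F)) - 1) + sqrt (real (card (carrier F))))"
    using difference_size_ideal_Times_Units difference_size_carrier_Times_coset
    unfolding F by (simp add: distrib_left mult.assoc)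
  show "difference_char (add_units_group R) (carrier R \<times> Units R)
      < sqrt (1 - 1 / real (card (carrier F)))
        + 4 / sqrt 3 * (1 / sqrt (real (card (carrier F)))
                        + 1 / sqrt (real (card (carrier F)) - 1))"
    unfolding F by (rule difference_char_carrier_less)
qed

end
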